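(* Let $\{Y_n;n\ge1\}$ be a sequence of independent and identically distributed random variables in a sub-linear expectation space $(\Omega,\mathscr H,\widehat{\mathbb E})$, let $\mathbb V$ be a sub-additive capacity on $\mathcal F$ satisfying the compatibility property (C), and let $\widehat{\mathbb V}^*$ be the countably sub-additive extension of $\widehat{\mathbb V}$. Suppose $$C_{\mathbb V}\left[\frac{Y_1^2}{\log\log|Y_1|}\right]<\infty .$$ Denote $\overline\sigma_2^2=\breve{\mathbb E}[(Y_1-\breve{\mathbb E}[Y_1])^2]$ and $\overline\sigma_1^2=\breve{\mathbb E}[(Y_1+\breve{\mathbb E}[-Y_1])^2]$ (finite or infinite). Then $$\widehat{\mathbb V}^*\left(\liminf_{n\to\infty}\frac{\sum_{i=1}^n(Y_i+\breve{\mathbb E}[-Y_i])}{\sqrt{2n\log\log n}}<-\overline\sigma_1\ \text{ or }\ \limsup_{n\to\infty}\frac{\sum_{i=1}^n(Y_i-\breve{\mathbb E}[Y_i])}{\sqrt{2n\log\log n}}>\overline\sigma_2\right)=0.$$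
   Context: Sub-linear expectation space: $(\Omega,\mathcal F)$ is a measurable space and $\mathscr H$ is a linear space of real measurable functions on it such that $\varphi(X_1,\dots,X_n)\in\mathscr H$ whenever $X_1,\dots,X_n\in\mathscr H$ and $\varphi\in C_{l,Lip}(\mathbb R^n)$, where $C_{l,Lip}(\mathbb R^n)$ is the set of $\varphi$ with $|\varphi(x)-\varphi(y)|\le C(1+|x|^m+|y|^m)|x-y|$ for some $C>0$, $m\in\mathbb N$ depending on $\varphi$. A sub-linear expectation is a map $\widehat{\mathbb E}:\mathscr H\to[-\infty,\infty]$ such that: $X\ge Y$ implies $\widehat{\mathbb E}[X]\ge\widehat{\mathbb E}[Y]$; $\widehat{\mathbb E}[c]=c$ for constants $c$; $\widehat{\mathbb E}[X+Y]\le\widehat{\mathbb E}[X]+\widehat{\mathbb E}[Y]$ whenever the right side is not of the form $\infty-\infty$; $\widehat{\mathbb E}[\lambda X]=\lambda\widehat{\mathbb E}[X]$ for $\lambda\ge0$ (with $0\cdot\infty=0$). Elements of $\mathscr H$ are called random variables. Independence: a random vector $\bm Y\in\mathscr H^n$ is independent to $\bm X\in\mathscr H^m$ if $\widehat{\mathbb E}[\varphi(\bm X,\bm Y)]=\widehat{\mathbb E}\big[\widehat{\mathbb E}[\varphi(\bm x,\bm Y)]|_{\bm x=\bm X}\big]$ for each $\varphi\in C_{l,Lip}(\mathbb R^m\times\mathbb R^n)$ with $\overline\varphi(\bm x):=\widehat{\mathbb E}[|\varphi(\bm x,\bm Y)|]<\infty$ for all $\bm x$ and $\widehat{\mathbb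 E}[|\overline\varphi(\bm X)|]<\infty$. A sequence $\{Y_n\}$ is independent if $Y_{i+1}$ is independent to $(Y_1,\dots,Y_i)$ for each $i\ge1$; it is identically distributed if $\widehat{\mathbb E}[\varphi(Y_i)]=\widehat{\mathbb E}[\varphi(Y_1)]$ for all bounded Lipschitz $\varphi$ and all $i$. Capacities: a capacity is a monotone set function $V:\mathcal F\to[0,1]$ with $V(\emptyset)=0$, $V(\Omega)=1$; it is sub-additive if $V(A\cup B)\le V(A)+V(B)$. Property (C) for $\mathbb V$: $\widehat{\mathbb E}[f]\le\mathbb V(A)\le\widehat{\mathbb E}[g]$ whenever $f\le I_A\le g$, $f,g\in\mathscr H$, $A\in\mathcal F$. Define $\widehat{\mathbb V}(A)=\inf\{\widehat{\mathbb E}[\xi]:I_A\le\xi,\ \xi\in\mathscr H\}$ and $\widehat{\mathbb V}^*(A)=\inf\{\sum_{n=1}^\infty\widehat{\mathbb V}(A_n):A\subset\bigcup_{n=1}^\infty A_n\}$, $A,A_n\in\mathcal F$. The Choquet integral is $C_V[X]=\int_0^\infty V(X\ge t)\,dt+\int_{-\infty}^0[V(X\ge t)-1]\,dt$. For a random variable $X$, $\breve{\mathbb E}[X]=\lim_{c\to\infty}\widehat{\mathbb E}[(-c)\vee(X\wedge c)]$ if the limit exists (it exists and is finite for $\pm Y_1$ under the stated hypothesis). Conventions: $\log x=\ln\max(e,x)$; $x\wedge y=\min(x,y)$, $x\vee y=\max(x,y)$. *)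

theory Defs
  imports "HOL-Analysis.Analysis"
begin

text \<open>
  Points of \<open>\<real>\<^sup>n\<close> with varying \<open>n\<close> are represented by functions \<^typ>\<open>nat \<Rightarrow> real\<close> of which only the
  coordinates \<open>0, \<dots>, n - 1\<close> matter, the Euclidean norm being \<open>L2_set x {..<n}\<close>. The growth
  condition below forces \<open>\<phi> x = \<phi> y\<close> whenever \<open>x\<close> and \<open>y\<close> agree on these coordinates.
\<close>

definition C_l_Lip :: "nat \<Rightarrow> ((nat \<Rightarrow> real) \<Rightarrow> real) set" where
  "C_l_Lip n = {\<phi>. \<exists>C>0. \<exists>m::nat. \<forall>x y.
     \<bar>\<phi> x - \<phi> y\<bar> \<le> C * (1 + L2_set x {..<n} ^ m + L2_set y {..<n} ^ m)
                      * L2_set (\<lambda>i. x i - y i) {..<n}}"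

definition vec_append :: "nat \<Rightarrow> (nat \<Rightarrow> real) \<Rightarrow> (nat \<Rightarrow> real) \<Rightarrow> nat \<Rightarrow> real" where
  "vec_append m x y = (\<lambda>i. if i < m then x i else y (i - m))"

text \<open>
  \<open>(\<Omega>, \<F>)\<close> is \<open>(space M, sets M)\<close>; the measure carried by \<open>M\<close> plays no role. Nothing is
  assumed about \<open>E\<close> outside \<open>H\<close>.
\<close>

locale sublinear_expectation_space =
  fixes M :: "'a measure" and H :: "('a \<Rightarrow> real) set" and E :: "('a \<Rightarrow> real) \<Rightarrow> ereal"
  assumes H_measurable: "H \<subseteq> borel_measurable M"
    and H_zero: "(\<lambda>_. 0) \<in> H"
    and H_add: "\<And>X Y. X \<in> H \<Longrightarrow> Y \<in> H \<Longrightarrow> (\<lambda>\<omega>. X \<omega> + Y \<omega>) \<in> H"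
    and H_scale: "\<And>X c. X \<in> H \<Longrightarrow> (\<lambda>\<omega>. c * X \<omega>) \<in> H"
    and H_C_l_Lip: "\<And>n X \<phi>. \<phi> \<in> C_l_Lip n \<Longrightarrow> (\<And>i. i < n \<Longrightarrow> X i \<in> H)
                      \<Longrightarrow> (\<lambda>\<omega>. \<phi> (\<lambda>i. X i \<omega>)) \<in> H"
    and E_mono: "\<And>X Y. X \<in> H \<Longrightarrow> Y \<in> H \<Longrightarrow> (\<And>\<omega>. \<omega> \<in> space M \<Longrightarrow> X \<omega> \<ge> Y \<omega>) \<Longrightarrow> E X \<ge> E Y"
    and E_const: "\<And>c. E (\<lambda>_. c) = ereal c"
    and E_subadd: "\<And>X Y. X \<in> H \<Longrightarrow> Y \<in> H
                      \<Longrightarrow> \<not> (E X = \<infinity> \<and> E Y = - \<infinity>) \<Longrightarrow> \<not> (E X = - \<infinity> \<and> E Y = \<infinity>)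
                      \<Longrightarrow> E (\<lambda>\<omega>. X \<omega> + Y \<omega>) \<le> E X + E Y"
    and E_pos_homogeneous: "\<And>X c. X \<in> H \<Longrightarrow> 0 \<le> c \<Longrightarrow> E (\<lambda>\<omega>. c * X \<omega>) = ereal c * E X"

text \<open>
  The identity is required for those test functions for which every expectation occurring in it
  is defined, i.e. taken of an element of \<open>H\<close>: if \<open>E\<close> takes infinite values, membership in \<open>H\<close>
  of the two functions obtained by substituting \<open>X\<close> is not automatic. Once
  \<open>E |\<phi>(x, Y)| < \<infinity>\<close> for all \<open>x\<close>, the values \<open>E (\<phi>(x, Y))\<close> are finite, so that
  \<^const>\<open>real_of_ereal\<close> is only a change of type.
\<close>

definition independent_to ::
  "('a \<Rightarrow> real) set \<Rightarrow> (('a \<Rightarrow> real) \<Rightarrow> ereal) \<Rightarrow>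
   nat \<Rightarrow> (nat \<Rightarrow> 'a \<Rightarrow> real) \<Rightarrow> nat \<Rightarrow> (nat \<Rightarrow> 'a \<Rightarrow> real) \<Rightarrow> bool" where
  "independent_to H E n Y m X \<longleftrightarrow>
     (\<forall>\<phi>\<in>C_l_Lip (m + n).
        let \<phi>_abs = (\<lambda>x. E (\<lambda>\<omega>. \<bar>\<phi> (vec_append m x (\<lambda>i. Y i \<omega>))\<bar>));
            \<phi>_sub = (\<lambda>x. E (\<lambda>\<omega>. \<phi> (vec_append m x (\<lambda>i. Y i \<omega>))));
            \<phi>_abs_X = (\<lambda>\<omega>. \<bar>real_of_ereal (\<phi>_abs (\<lambda>i. X i \<omega>))\<bar>);
            \<phi>_sub_X = (\<lambda>\<omega>. real_of_ereal (\<phi>_sub (\<lambda>i. X i \<omega>)))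
        in (\<forall>x. \<phi>_abs x < \<infinity>) \<and> \<phi>_abs_X \<in> H \<and> E \<phi>_abs_X < \<infinity> \<and> \<phi>_sub_X \<in> H \<longrightarrow>
           E (\<lambda>\<omega>. \<phi> (vec_append m (\<lambda>i. X i \<omega>) (\<lambda>i. Y i \<omega>))) = E \<phi>_sub_X)"

text \<open>Sequences are indexed from \<open>1\<close>; the value at \<open>0\<close> is irrelevant.\<close>

definition independent_seq ::
  "('a \<Rightarrow> real) set \<Rightarrow> (('a \<Rightarrow> real) \<Rightarrow> ereal) \<Rightarrow> (nat \<Rightarrow> 'a \<Rightarrow> real) \<Rightarrow> bool" where
  "independent_seq H E Y \<longleftrightarrow>
     (\<forall>i\<ge>1. independent_to H E 1 (\<lambda>_. Y (i + 1)) i (\<lambda>j. Y (j + 1)))"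

definition identically_distributed_seq ::
  "(('a \<Rightarrow> real) \<Rightarrow> ereal) \<Rightarrow> (nat \<Rightarrow> 'a \<Rightarrow> real) \<Rightarrow> bool" where
  "identically_distributed_seq E Y \<longleftrightarrow>
     (\<forall>i\<ge>1. \<forall>\<phi> :: real \<Rightarrow> real. bounded (range \<phi>) \<longrightarrow> (\<exists>L. L-lipschitz_on UNIV \<phi>) \<longrightarrow>
        E (\<lambda>\<omega>. \<phi> (Y i \<omega>)) = E (\<lambda>\<omega>. \<phi> (Y 1 \<omega>)))"

definition capacity :: "'a measure \<Rightarrow> ('a set \<Rightarrow> real) \<Rightarrow> bool" where
  "capacity M V \<longleftrightarrow>
     (\<forall>A\<in>sets M. 0 \<le> V A \<and> V A \<le> 1) \<and>
     (\<forall>A\<in>sets M. \<forall>B\<in>sets M. A \<subseteq> B \<longrightarrow> V A \<le> V B) \<and>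
     V {} = 0 \<and> V (space M) = 1"

definition subadditive_capacity :: "'a measure \<Rightarrow> ('a set \<Rightarrow> real) \<Rightarrow> bool" where
  "subadditive_capacity M V \<longleftrightarrow>
     capacity M V \<and> (\<forall>A\<in>sets M. \<forall>B\<in>sets M. V (A \<union> B) \<le> V A + V B)"

definition property_C ::
  "'a measure \<Rightarrow> ('a \<Rightarrow> real) set \<Rightarrow> (('a \<Rightarrow> real) \<Rightarrow> ereal) \<Rightarrow> ('a set \<Rightarrow> real) \<Rightarrow> bool" where
  "property_C M H E V \<longleftrightarrow>
     (\<forall>f\<in>H. \<forall>g\<in>H. \<forall>A\<in>sets M.
        (\<forall>\<omega>\<in>space M. f \<omega> \<le> indicator A \<omega> \<and> indicator A \<omega> \<le> g \<omega>) \<longrightarrow>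
        E f \<le> ereal (V A) \<and> ereal (V A) \<le> E g)"

definition V_hat ::
  "'a measure \<Rightarrow> ('a \<Rightarrow> real) set \<Rightarrow> (('a \<Rightarrow> real) \<Rightarrow> ereal) \<Rightarrow> 'a set \<Rightarrow> ereal" where
  "V_hat M H E A = Inf {E \<xi> | \<xi>. \<xi> \<in> H \<and> (\<forall>\<omega>\<in>space M. indicator A \<omega> \<le> \<xi> \<omega>)}"

definition V_hat_star ::
  "'a measure \<Rightarrow> ('a \<Rightarrow> real) set \<Rightarrow> (('a \<Rightarrow> real) \<Rightarrow> ereal) \<Rightarrow> 'a set \<Rightarrow> ereal" where
  "V_hat_star M H E A =
     Inf {(\<Sum>n. V_hat M H E (B n)) | B :: nat \<Rightarrow> 'a set. range B \<subseteq> sets M \<and> A \<subseteq> (\<Union>n. B n)}"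

text \<open>
  Both integrands are nonnegative and monotone in \<open>t\<close>, so the two (possibly improper) Riemann
  integrals are Lebesgue integrals with values in \<open>[0, \<infinity>]\<close>; the second one enters with a minus
  sign because its integrand is \<open>1 - V (X \<ge> t)\<close>.
\<close>

definition choquet :: "'a measure \<Rightarrow> ('a set \<Rightarrow> real) \<Rightarrow> ('a \<Rightarrow> real) \<Rightarrow> ereal" where
  "choquet M V X =
     enn2ereal (\<integral>\<^sup>+t\<in>{0..}. ennreal (V {\<omega>\<in>space M. X \<omega> \<ge> t}) \<partial>lborel) -
     enn2ereal (\<integral>\<^sup>+t\<in>{..0}. ennreal (1 - V {\<omega>\<in>space M. X \<omega> \<ge> t}) \<partial>lborel)"

definition breve_E :: "(('a \<Rightarrow> real) \<Rightarrow> ereal) \<Rightarrow> ('a \<Rightarrow> real) \<Rightarrow> ereal" where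
  "breve_E E X = Lim at_top (\<lambda>c::real. E (\<lambda>\<omega>. max (- c) (min (X \<omega>) c)))"

definition Log :: "real \<Rightarrow> real" where
  "Log x = ln (max (exp 1) x)"

end

theory Submission
  imports Defs
begin

text \<open>
  Fix \<open>l > 1\<close> and cut time into the blocks \<open>(l\<^sup>k, l\<^sup>k\<^sup>+\<^sup>1]\<close>. In block \<open>k\<close> the variables are clipped at a small
  multiple \<open>b\<^sub>k\<close> of the level \<open>x\<^sub>k\<close> that the sums have to exceed, where \<open>x\<^sub>k\<close> is of order
  \<open>sqrt (l\<^sup>k * log log l\<^sup>k)\<close>; by the Choquet condition the probabilities that a clipped variable differs from
  the original one are summable over all blocks, and the same condition makes the drift caused by
  clipping negligible. A maximal inequality for the exponential supermartingale of the clipped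
  variables, whose stopping rule is replaced by a Lipschitz function of the path because independence is
  available only for such functions, leaves an exponent \<open>h\<close> to choose. Bounding \<open>exp\<close> by a quadratic
  plus a quartic term, a Fuk-Nagaev type choice \<open>h = min (x / B) (2 * L / x)\<close> with \<open>L = - ln \<epsilon>\<^sub>k\<close>, where
  \<open>\<epsilon>\<^sub>k\<close> is the normalised fourth moment of block \<open>k\<close>, bounds the capacity of the block event by
  a multiple of \<open>exp (- x\<^sup>2 / (2 * B)) + \<epsilon>\<^sub>k\<close>. This is summable, and a Borel-Cantelli argument concludes.
  The lower limit is the upper limit for \<open>- Y\<close>.
\<close>

section \<open>Iterated logarithms and bounded Lipschitz functions\<close>

text \<open>Since \<open>E\<close> is only subadditive and may be infinite, every estimate is an
  upper bound for a bounded Lipschitz test function. On such functions \<open>E\<close> is finite,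
  and partial expectations are again bounded and Lipschitz, so the side conditions in the definition
  of independence can be verified. As \<open>V_hat\<close> is an infimum over test functions,
  bounding an event means exhibiting one function above its indicator. The fourth moment enters
  because the Choquet condition controls only the series of \<open>l ^ j\<close> times the tail
  weight at level \<open>j\<close>. In a normalised second moment the levels below \<open>k\<close>
  contribute to block \<open>k\<close> without decay in \<open>k - j\<close>; a power above 2 adds a
  geometric factor in \<open>k - j\<close>, and 4 is the first even one. The gap between the
  variance root and the tested slope \<open>r\<close> is spent on three losses: the drift from
  clipping, the ratio \<open>l\<close> between the two ends of a block, and the factor
  \<open>exp \<eta>\<close> in front of the quadratic term. The last two are both set equal to
  \<open>l\<close>, and a strict excess over the critical exponent 1 remains.\<close>

lemma Log_ge_1: "1 \<le> Log x"
proof -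
  have "ln (exp 1) \<le> ln (max (exp 1) x)"
    by (subst ln_le_cancel_iff) (auto simp: less_max_iff_disj)
  then show ?thesis
    by (simp add: Log_def)
qed

lemma Log_mono: "x \<le> y \<Longrightarrow> Log x \<le> Log y"
  unfolding Log_def by (subst ln_le_cancel_iff) (auto simp: less_max_iff_disj)

lemma Log_le_self:
  assumes "1 \<le> x"
  shows "Log x \<le> x"
proof (cases "x \<le> exp 1")
  case True
  then show ?thesis using assms by (simp add: Log_def max_absorb1)
next
  case False
  then show ?thesis using assms ln_le_minus_one[of x] by (simp add: Log_def max_absorb2)
qed

lemma Log_mult_le:
  assumes "0 \<le> x" "0 \<le> y"
  shows "Log (x * y) \<le> Log x + Log y"
proof -
  let ?e = "exp 1 :: real"
  have "x * y \<le> max ?e x * max ?e y"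
    by (rule mult_mono) (use assms in auto)
  moreover have "?e * 1 \<le> max ?e x * max ?e y"
    by (rule mult_mono) (auto simp: le_max_iff_disj)
  ultimately have "ln (max ?e (x * y)) \<le> ln (max ?e x * max ?e y)"
    by (subst ln_le_cancel_iff) (auto simp: less_max_iff_disj intro!: mult_pos_pos)
  also have "\<dots> = ln (max ?e x) + ln (max ?e y)"
    by (rule ln_mult_pos) (auto simp: less_max_iff_disj)
  finally show ?thesis by (simp add: Log_def)
qed

abbreviation LL :: "real \<Rightarrow> real" where
  "LL x \<equiv> Log (Log x)"

lemma LL_mono: "x \<le> y \<Longrightarrow> LL x \<le> LL y"
  by (intro Log_mono)

lemma LL_pos: "0 < LL x"
  using Log_ge_1[of "Log x"] by linarith

lemma LL_le_self: "1 \<le> x \<Longrightarrow> LL x \<le> x"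
  using Log_le_self[of x] Log_le_self[of "Log x"] Log_ge_1[of x] by linarith

text \<open>All iterated logarithms are at least 1, so a sum of them is at most a multiple of their
  product. This is used twice: inside the outer \<open>Log\<close>, as a + b <= 2ab, and outside it,
  as 1 + u + v <= 3uv.\<close>

lemma LL_mult_le:
  assumes "0 \<le> x" "0 \<le> y"
  shows "LL (x * y) \<le> 3 * LL x * LL y"
proof -
  let ?a = "Log x" and ?b = "Log y"
  have 1: "1 \<le> ?a" "1 \<le> ?b" by (rule Log_ge_1)+
  have "(?a - 1) * ?b \<ge> 0" "(?b - 1) * ?a \<ge> 0"
    using 1 by (auto intro!: mult_nonneg_nonneg)
  then have "?a + ?b \<le> 2 * (?a * ?b)"
    by (simp add: algebra_simps)
  then have "Log (x * y) \<le> 2 * (?a * ?b)"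
    using Log_mult_le[OF assms] by linarith
  then have "LL (x * y) \<le> Log (2 * (?a * ?b))" by (rule Log_mono)
  also have "\<dots> \<le> Log 2 + (Log ?a + Log ?b)"
    using Log_mult_le[of 2 "?a * ?b"] Log_mult_le[of ?a ?b] 1 by force
  also have "Log 2 = 1"
    using exp_ge_add_one_self[of "1::real"] by (simp add: Log_def max_absorb1)
  also have "1 + (Log ?a + Log ?b) \<le> 3 * LL x * LL y"
  proof -
    have 2: "1 \<le> LL x" "1 \<le> LL y" by (rule Log_ge_1)+
    have "(LL x - 1) * LL y \<ge> 0" "(LL y - 1) * LL x \<ge> 0" "(LL x - 1) * (LL y - 1) \<ge> 0"
      using 2 by (auto intro!: mult_nonneg_nonneg)
    moreover have "1 * 1 \<le> LL x * LL y" using 2 by (intro mult_mono) auto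
    ultimately show ?thesis by (simp add: algebra_simps)
  qed
  finally show ?thesis .
qed

text \<open>\<open>Log (l ^ k)\<close> is at least \<open>k * ln l\<close>, so the double logarithm
  turns the exponential into a power of \<open>k\<close>. Summability for \<open>1 < q\<close> is
  what makes the normalisation by the iterated logarithm the right one.\<close>

lemma exp_LL_le:
  fixes l q :: real
  assumes "1 < l" "0 < q" "0 < k"
  shows "exp (- (q * LL (l ^ k))) \<le> (real k * ln l) powr - q"
proof -
  have p: "0 < real k * ln l" using assms by simp
  have "real k * ln l = ln (l ^ k)" using assms by (simp add: ln_realpow)
  also have "\<dots> \<le> Log (l ^ k)"
    unfolding Log_def using assms by (subst ln_le_cancel_iff) (auto simp: less_max_iff_disj)
  finally have "real k * ln l \<le> Log (l ^ k)" .
  then have "ln (real k * ln l) \<le> LL (l ^ k)"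
    unfolding Log_def[of "Log (l ^ k)"]
    using p by (subst ln_le_cancel_iff) (auto simp: less_max_iff_disj)
  then show ?thesis using assms p by (simp add: powr_def)
qed

lemma summable_exp_LL:
  fixes l q :: real
  assumes "1 < l" "1 < q"
  shows "summable (\<lambda>k. exp (- (q * LL (l ^ k))))"
proof (rule summable_comparison_test')
  have "summable (\<lambda>k. real k powr - q * ln l powr - q)"
    by (intro summable_mult2) (use assms in \<open>simp add: summable_real_powr_iff\<close>)
  then show "summable (\<lambda>k. (real k * ln l) powr - q)"
    using assms by (simp add: powr_mult)
  show "norm (exp (- (q * LL (l ^ k)))) \<le> (real k * ln l) powr - q" if "k \<ge> 1" for k
    using exp_LL_le[of l q k] assms that by simp
qed

text \<open>Up to \<open>\<eta>\<close> this is Taylor's formula with the second derivative bounded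
  by \<open>exp \<eta>\<close>; beyond \<open>\<eta>\<close> the factor
  \<open>(z / \<eta>) ^ 4\<close> is at least 1 and the last term alone dominates. A small
  \<open>\<eta>\<close> brings the quadratic coefficient close to 1/2, at the price of a large
  quartic one.\<close>

lemma exp_le_quadratic_plus_quartic:
  fixes z \<eta> :: real
  assumes "0 < \<eta>"
  shows "exp z \<le> 1 + z + exp \<eta> * z\<^sup>2 / 2 + (z / \<eta>) ^ 4 * exp \<bar>z\<bar>"
proof -
  have quart: "0 \<le> (z / \<eta>) ^ 4 * exp \<bar>z\<bar>" by simp
  show ?thesis
  proof (cases "z \<le> \<eta>")
    case True
    obtain t where t: "\<bar>t\<bar> \<le> \<bar>z\<bar>"
      and eq: "exp z = (\<Sum>m<2. z ^ m / fact m) + exp t / fact 2 * z ^ 2"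
      using Maclaurin_exp_le[of z 2] by blast
    have "exp z \<le> 1 + z + exp \<eta> * z\<^sup>2 / 2"
    proof (cases "z \<ge> 0")
      case z: True
      have "exp t * z\<^sup>2 \<le> exp \<eta> * z\<^sup>2"
        using t z \<open>z \<le> \<eta>\<close> by (intro mult_right_mono) auto
      then show ?thesis using eq by (simp add: numeral_2_eq_2 power2_eq_square)
    next
      case z: False
      \<comment> \<open>The second-order remainder has derivative \<open>exp u - 1 - u\<close>,
        which is nonnegative; hence at a negative \<open>z\<close> it is at most its value at
        0.\<close>
      have mono: "exp z - 1 - z - z\<^sup>2 / 2 \<le> exp 0 - 1 - 0 - 0\<^sup>2 / (2 :: real)"
      proof (rule DERIV_nonneg_imp_nondecreasing[where f = "\<lambda>u. exp u - 1 - u - u\<^sup>2 / 2"])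
        show "z \<le> 0" using z by simp
        fix u :: real
        show "\<exists>y. ((\<lambda>u. exp u - 1 - u - u\<^sup>2 / 2) has_real_derivative y) (at u) \<and> 0 \<le> y"
          by (rule exI[of _ "exp u - 1 - u"])
             (use exp_ge_add_one_self[of u] in \<open>auto intro!: derivative_eq_intros simp: algebra_simps\<close>)
      qed
      have "1 * z\<^sup>2 \<le> exp \<eta> * z\<^sup>2"
        using assms by (intro mult_right_mono) auto
      then show ?thesis using mono by simp
    qed
    then show ?thesis using quart by linarith
  next
    case False
    have "1 \<le> (z / \<eta>) ^ 4" using False assms by (intro one_le_power) simp
    then have "1 * exp z \<le> (z / \<eta>) ^ 4 * exp \<bar>z\<bar>"
      using False assms by (intro mult_mono) auto
    moreover have "0 \<le> exp \<eta> * z\<^sup>2 / 2" "0 \<le> 1 + z" using False assms by auto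
    ultimately show ?thesis by linarith
  qed
qed

text \<open>Only the fourth-order term of the exponential series at \<open>x / 2\<close> is kept:
  384 is 2^4 times 4!.\<close>

lemma power4_le_exp:
  fixes x :: real
  assumes "0 \<le> x"
  shows "x ^ 4 \<le> 384 * exp (x / 2)"
proof -
  have "(\<Sum>m<5. (x / 2) ^ m / fact m) \<le> exp (x / 2)"
    using Maclaurin_exp_le[of "x / 2" 5] assms by (force intro!: mult_nonneg_nonneg)
  moreover have "(x / 2) ^ 4 / 24 \<le> (\<Sum>m<5. (x / 2) ^ m / fact m)"
    using assms by (simp add: eval_nat_numeral)
  ultimately show ?thesis by (simp add: power_divide)
qed

text \<open>Clipping at a negative level returns the constant \<open>- b\<close>.\<close>

definition clip :: "real \<Rightarrow> real \<Rightarrow> real" where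
  "clip b y = max (- b) (min y b)"

lemma abs_clip_le: "\<bar>clip b y\<bar> \<le> \<bar>b\<bar>"
  by (auto simp: clip_def)

lemma clip_lipschitz: "\<bar>clip b x - clip b y\<bar> \<le> \<bar>x - y\<bar>"
  by (auto simp: clip_def)

lemma clip_eq_self: "\<bar>y\<bar> \<le> b \<Longrightarrow> clip b y = y"
  by (auto simp: clip_def)

lemma abs_clip_eq: "0 \<le> b \<Longrightarrow> \<bar>clip b y\<bar> = min \<bar>y\<bar> b"
  by (auto simp: clip_def)

text \<open>A Lipschitz stand-in for the indicator of \<open>b \<le> \<bar>y\<bar>\<close>: for
  positive \<open>b\<close> it grows linearly from 0 at \<open>\<bar>y\<bar> = b / 2\<close> to 1 at
  \<open>\<bar>y\<bar> = b\<close>.\<close>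

definition hat :: "real \<Rightarrow> real \<Rightarrow> real" where
  "hat b y = clip 1 (max 0 (2 * \<bar>y\<bar> / b - 1))"

lemma hat_bounds: "0 \<le> hat b y" "hat b y \<le> 1"
  by (auto simp: hat_def clip_def)

lemma hat_eq_1: "0 < b \<Longrightarrow> b \<le> \<bar>y\<bar> \<Longrightarrow> hat b y = 1"
  by (auto simp: hat_def clip_def field_simps)

lemma hat_eq_0: "0 < b \<Longrightarrow> \<bar>y\<bar> \<le> b / 2 \<Longrightarrow> hat b y = 0"
  by (auto simp: hat_def clip_def field_simps max_def)

lemma hat_minus: "hat b (- y) = hat b y"
  by (simp add: hat_def)

text \<open>The distance is a parameter so that the same closure rules serve functions on the line
  and functions of finitely many coordinates. Boundedness is included because it makes the class
  closed under products and exponentials.\<close>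

definition bdd_Lip :: "('b \<Rightarrow> 'b \<Rightarrow> real) \<Rightarrow> ('b \<Rightarrow> real) \<Rightarrow> bool" where
  "bdd_Lip d f \<longleftrightarrow> (\<exists>B. \<forall>x. \<bar>f x\<bar> \<le> B) \<and> (\<exists>L. \<forall>x y. \<bar>f x - f y\<bar> \<le> L * d x y)"

lemma bdd_LipI:
  "(\<And>x. \<bar>f x\<bar> \<le> B) \<Longrightarrow> (\<And>x y. \<bar>f x - f y\<bar> \<le> L * d x y) \<Longrightarrow> bdd_Lip d f"
  unfolding bdd_Lip_def by blast

lemma bdd_LipE:
  assumes "bdd_Lip d f"
  obtains B L where "0 \<le> B" "\<And>x. \<bar>f x\<bar> \<le> B" "\<And>x y. \<bar>f x - f y\<bar> \<le> L * d x y"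
  using assms unfolding bdd_Lip_def by (meson abs_ge_zero order_trans)

lemma bdd_Lip_const: "bdd_Lip d (\<lambda>_. c)"
  by (rule bdd_LipI[where B = "\<bar>c\<bar>" and L = 0]) auto

lemma bdd_Lip_add:
  assumes "bdd_Lip d f" "bdd_Lip d g"
  shows "bdd_Lip d (\<lambda>x. f x + g x)"
proof -
  obtain B L where f: "\<And>x. \<bar>f x\<bar> \<le> B" "\<And>x y. \<bar>f x - f y\<bar> \<le> L * d x y"
    using assms(1) by (rule bdd_LipE) blast
  obtain B' L' where g: "\<And>x. \<bar>g x\<bar> \<le> B'" "\<And>x y. \<bar>g x - g y\<bar> \<le> L' * d x y"
    using assms(2) by (rule bdd_LipE) blast
  show ?thesis
  proof (rule bdd_LipI)
    show "\<bar>f x + g x\<bar> \<le> B + B'" for x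
      using f(1)[of x] g(1)[of x] by linarith
    show "\<bar>f x + g x - (f y + g y)\<bar> \<le> (L + L') * d x y" for x y
      using f(2)[of x y] g(2)[of x y] unfolding distrib_right by linarith
  qed
qed

lemma bdd_Lip_mult:
  assumes "bdd_Lip d f" "bdd_Lip d g"
  shows "bdd_Lip d (\<lambda>x. f x * g x)"
proof -
  obtain B L where f: "0 \<le> B" "\<And>x. \<bar>f x\<bar> \<le> B" "\<And>x y. \<bar>f x - f y\<bar> \<le> L * d x y"
    using assms(1) by (rule bdd_LipE) blast
  obtain B' L' where g: "0 \<le> B'" "\<And>x. \<bar>g x\<bar> \<le> B'" "\<And>x y. \<bar>g x - g y\<bar> \<le> L' * d x y"
    using assms(2) by (rule bdd_LipE) blast
  show ?thesis
  proof (rule bdd_LipI)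
    show "\<bar>f x * g x\<bar> \<le> B * B'" for x
      unfolding abs_mult using f g by (intro mult_mono) auto
    show "\<bar>f x * g x - f y * g y\<bar> \<le> (B * L' + B' * L) * d x y" for x y
    proof -
      have "f x * g x - f y * g y = f x * (g x - g y) + g y * (f x - f y)"
        by (simp add: algebra_simps)
      then have "\<bar>f x * g x - f y * g y\<bar> \<le> \<bar>f x\<bar> * \<bar>g x - g y\<bar> + \<bar>g y\<bar> * \<bar>f x - f y\<bar>"
        by (simp add: abs_mult[symmetric])
      also have "\<dots> \<le> B * (L' * d x y) + B' * (L * d x y)"
        using f g by (intro add_mono mult_mono) auto
      finally show ?thesis by (simp add: algebra_simps)
    qed
  qed
qed

lemma bdd_Lip_diff:
  assumes "bdd_Lip d f" "bdd_Lip d g"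
  shows "bdd_Lip d (\<lambda>x. f x - g x)"
  using bdd_Lip_add[OF assms(1) bdd_Lip_mult[OF bdd_Lip_const[of d "-1"] assms(2)]] by simp

lemma bdd_Lip_power:
  "bdd_Lip d f \<Longrightarrow> bdd_Lip d (\<lambda>x. f x ^ n)"
  by (induction n) (auto intro: bdd_Lip_const bdd_Lip_mult)

lemma bdd_Lip_contraction:
  assumes "bdd_Lip d f" and "\<And>x y. \<bar>h x - h y\<bar> \<le> K * \<bar>x - y\<bar>" and "0 \<le> K"
  shows "bdd_Lip d (\<lambda>x. h (f x))"
proof -
  obtain B L where f: "0 \<le> B" "\<And>x. \<bar>f x\<bar> \<le> B" "\<And>x y. \<bar>f x - f y\<bar> \<le> L * d x y"
    using assms(1) by (rule bdd_LipE) blast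
  show ?thesis
  proof (rule bdd_LipI)
    fix x
    have "\<bar>h (f x) - h 0\<bar> \<le> K * B"
      using assms(2)[of "f x" 0] mult_left_mono[OF f(2)[of x] assms(3)] by simp
    then show "\<bar>h (f x)\<bar> \<le> \<bar>h 0\<bar> + K * B" by linarith
  next
    fix x y
    show "\<bar>h (f x) - h (f y)\<bar> \<le> (K * L) * d x y"
      using assms(2)[of "f x" "f y"] mult_left_mono[OF f(3)[of x y] assms(3)]
      by (simp add: mult.assoc)
  qed
qed

lemma bdd_Lip_abs: "bdd_Lip d f \<Longrightarrow> bdd_Lip d (\<lambda>x. \<bar>f x\<bar>)"
  by (rule bdd_Lip_contraction[where K = 1]) auto

lemma bdd_Lip_exp:
  assumes "bdd_Lip d f"
  shows "bdd_Lip d (\<lambda>x. exp (f x))"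
proof -
  obtain B L where f: "0 \<le> B" "\<And>x. \<bar>f x\<bar> \<le> B" "\<And>x y. \<bar>f x - f y\<bar> \<le> L * d x y"
    using assms(1) by (rule bdd_LipE) blast
  have le: "exp u - exp v \<le> exp B * \<bar>u - v\<bar>" if "\<bar>u\<bar> \<le> B" for u v :: real
  proof -
    have "exp u * (1 + (v - u)) \<le> exp u * exp (v - u)"
      by (intro mult_left_mono) (simp_all add: exp_ge_add_one_self del: add_diff_eq)
    then have "exp u - exp v \<le> exp u * (u - v)"
      by (simp add: exp_add[symmetric] algebra_simps)
    also have "\<dots> \<le> exp u * \<bar>u - v\<bar>" by (intro mult_left_mono) auto
    also have "\<dots> \<le> exp B * \<bar>u - v\<bar>" using that by (intro mult_right_mono) auto
    finally show ?thesis .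
  qed
  show ?thesis
  proof (rule bdd_LipI)
    show "\<bar>exp (f x)\<bar> \<le> exp B" for x
      using f(2)[of x] by simp
    show "\<bar>exp (f x) - exp (f y)\<bar> \<le> (exp B * L) * d x y" for x y
    proof -
      have "\<bar>exp (f x) - exp (f y)\<bar> \<le> exp B * \<bar>f x - f y\<bar>"
        using le[OF f(2)[of x], of "f y"] le[OF f(2)[of y], of "f x"]
        by (simp add: abs_minus_commute abs_le_iff)
      also have "\<dots> \<le> exp B * (L * d x y)"
        using f(3) by (intro mult_left_mono) auto
      finally show ?thesis by (simp add: mult.assoc)
    qed
  qed
qed

abbreviation rdist :: "real \<Rightarrow> real \<Rightarrow> real" where
  "rdist x y \<equiv> \<bar>x - y\<bar>"

text \<open>The l1 distance is used instead of the Euclidean one because it is additive in the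
  coordinates: changing only the last coordinate, or only the earlier ones, leaves exactly the
  corresponding part of the sum.\<close>

abbreviation ldist :: "nat \<Rightarrow> (nat \<Rightarrow> real) \<Rightarrow> (nat \<Rightarrow> real) \<Rightarrow> real" where
  "ldist n x y \<equiv> (\<Sum>i<n. \<bar>x i - y i\<bar>)"

lemma bdd_Lip_clip: "bdd_Lip rdist (clip b)"
  by (rule bdd_LipI[where B = "\<bar>b\<bar>" and L = 1]) (auto simp: abs_clip_le clip_lipschitz)

lemma hat_lipschitz:
  assumes "0 < b"
  shows "\<bar>hat b x - hat b y\<bar> \<le> (2 / b) * \<bar>x - y\<bar>"
proof -
  have "\<bar>hat b x - hat b y\<bar> \<le> \<bar>max 0 (2 * \<bar>x\<bar> / b - 1) - max 0 (2 * \<bar>y\<bar> / b - 1)\<bar>"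
    unfolding hat_def by (rule clip_lipschitz)
  also have "\<dots> \<le> \<bar>2 * \<bar>x\<bar> / b - 2 * \<bar>y\<bar> / b\<bar>" by linarith
  also have "\<dots> = (2 / b) * \<bar>\<bar>x\<bar> - \<bar>y\<bar>\<bar>"
  proof -
    have "2 * \<bar>x\<bar> / b - 2 * \<bar>y\<bar> / b = (2 / b) * (\<bar>x\<bar> - \<bar>y\<bar>)" by (simp add: diff_divide_distrib algebra_simps)
    then show ?thesis using assms by (simp only: abs_mult) simp
  qed
  also have "\<dots> \<le> (2 / b) * \<bar>x - y\<bar>"
    using assms by (intro mult_left_mono abs_triangle_ineq3) simp
  finally show ?thesis .
qed

lemma bdd_Lip_hat: "0 < b \<Longrightarrow> bdd_Lip rdist (hat b)"
  by (rule bdd_LipI[where B = 1 and L = "2 / b"]) (use hat_bounds hat_lipschitz in \<open>auto simp: abs_le_iff\<close>)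

text \<open>The truncated square is the square of \<open>y - \<mu>\<close> clipped at
  \<open>sqrt c\<close>, so closure under powers applies although the square itself is not
  Lipschitz.\<close>

lemma bdd_Lip_min_square:
  assumes "0 \<le> c"
  shows "bdd_Lip rdist (\<lambda>y. min ((y - \<mu>)\<^sup>2) c)"
proof -
  have "min ((y - \<mu>)\<^sup>2) c = (clip (sqrt c) (y - \<mu>))\<^sup>2" for y
  proof -
    have "(clip (sqrt c) (y - \<mu>))\<^sup>2 = (min \<bar>y - \<mu>\<bar> (sqrt c))\<^sup>2"
      using assms abs_clip_eq[of "sqrt c" "y - \<mu>"] by (metis power2_abs real_sqrt_ge_zero)
    also have "\<dots> = min ((y - \<mu>)\<^sup>2) c"
    proof (cases "\<bar>y - \<mu>\<bar> \<le> sqrt c")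
      case True
      then show ?thesis using sqrt_ge_absD[OF True] by (simp add: min_absorb1)
    next
      case False
      then have "(sqrt c)\<^sup>2 \<le> \<bar>y - \<mu>\<bar>\<^sup>2" using assms by (intro power_mono) auto
      then show ?thesis using False assms by (simp add: min_absorb2)
    qed
    finally show ?thesis by simp
  qed
  moreover have "bdd_Lip rdist (\<lambda>y. clip (sqrt c) (y - \<mu>))"
    by (rule bdd_LipI[where B = "\<bar>sqrt c\<bar>" and L = 1])
       (use clip_lipschitz[of "sqrt c" "_ - \<mu>" "_ - \<mu>"] abs_clip_le in auto)
  ultimately show ?thesis using bdd_Lip_power[of rdist _ 2] by simp
qed

lemma bdd_Lip_coordinate:
  assumes "bdd_Lip rdist f" "i < n"
  shows "bdd_Lip (ldist n) (\<lambda>x. f (x i))"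
proof -
  obtain B L where f: "0 \<le> B" "\<And>x. \<bar>f x\<bar> \<le> B" "\<And>x y. \<bar>f x - f y\<bar> \<le> L * \<bar>x - y\<bar>"
    using assms(1) by (rule bdd_LipE) blast
  show ?thesis
  proof (rule bdd_LipI)
    show "\<bar>f (x i)\<bar> \<le> B" for x by (rule f)
    show "\<bar>f (x i) - f (y i)\<bar> \<le> \<bar>L\<bar> * ldist n x y" for x y
    proof -
      have "\<bar>f (x i) - f (y i)\<bar> \<le> \<bar>L\<bar> * \<bar>x i - y i\<bar>"
        using f(3)[of "x i" "y i"] mult_right_mono[OF abs_ge_self[of L], of "\<bar>x i - y i\<bar>"] by simp
      also have "\<dots> \<le> \<bar>L\<bar> * ldist n x y"
        using assms(2) by (intro mult_left_mono member_le_sum) auto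
      finally show ?thesis .
    qed
  qed
qed

lemma bdd_Lip_imp_C_l_Lip:
  assumes "bdd_Lip (ldist n) \<phi>"
  shows "\<phi> \<in> C_l_Lip n"
proof -
  obtain B L where f: "0 \<le> B" "\<And>x. \<bar>\<phi> x\<bar> \<le> B" "\<And>x y. \<bar>\<phi> x - \<phi> y\<bar> \<le> L * ldist n x y"
    using assms(1) by (rule bdd_LipE) blast
  \<comment> \<open>The growth exponent is taken to be 0, so the polynomial factor is the constant
    3. The factor \<open>n\<close> compares the l1 norm with the Euclidean norm, and the added 1
    makes \<open>C\<close> positive.\<close>
  define C where "C = \<bar>L\<bar> * real n + 1"
  have "\<bar>\<phi> x - \<phi> y\<bar> \<le> C * (1 + L2_set x {..<n} ^ 0 + L2_set y {..<n} ^ 0)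
          * L2_set (\<lambda>i. x i - y i) {..<n}" for x y
  proof -
    let ?N = "L2_set (\<lambda>i. x i - y i) {..<n}"
    have N: "0 \<le> ?N" by simp
    have "ldist n x y \<le> real (card {..<n}) * ?N"
      by (rule sum_bounded_above) (use member_le_L2_set[of "{..<n}" _ "\<lambda>i. \<bar>x i - y i\<bar>"] in
            \<open>auto simp: L2_set_def\<close>)
    then have "\<bar>L\<bar> * ldist n x y \<le> \<bar>L\<bar> * (real n * ?N)"
      by (intro mult_left_mono) auto
    moreover have "L * ldist n x y \<le> \<bar>L\<bar> * ldist n x y"
      by (intro mult_right_mono sum_nonneg) auto
    moreover have "\<bar>L\<bar> * (real n * ?N) \<le> C * 3 * ?N"
    proof -
      have "\<bar>L\<bar> * real n * ?N \<le> C * 3 * ?N"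
        using N by (intro mult_right_mono) (auto simp: C_def)
      then show ?thesis by (simp add: mult.assoc)
    qed
    ultimately show ?thesis using f(3)[of x y] by simp
  qed
  moreover have "C > 0" by (simp add: C_def add_nonneg_pos)
  ultimately show ?thesis unfolding C_l_Lip_def by blast
qed

lemma bdd_Lip_cong_coordinates:
  assumes "bdd_Lip (ldist n) \<phi>" "\<And>i. i < n \<Longrightarrow> x i = y i"
  shows "\<phi> x = \<phi> y"
proof -
  obtain L where "\<bar>\<phi> x - \<phi> y\<bar> \<le> L * ldist n x y"
    using assms(1) by (rule bdd_LipE) blast
  moreover have "ldist n x y = 0" using assms(2) by simp
  ultimately show ?thesis by simp
qed

section \<open>Bounded random variables and null sets\<close>

context sublinear_expectation_space
begin

text \<open>On bounded elements monotonicity and the values at constants force \<open>E\<close> to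
  be finite, so \<open>e\<close> obeys ordinary real arithmetic there.\<close>

definition bH :: "('a \<Rightarrow> real) set" where
  "bH = {X \<in> H. \<exists>B. \<forall>\<omega>\<in>space M. \<bar>X \<omega>\<bar> \<le> B}"

definition e :: "('a \<Rightarrow> real) \<Rightarrow> real" where
  "e X = real_of_ereal (E X)"

lemma bH_imp_H: "X \<in> bH \<Longrightarrow> X \<in> H"
  by (simp add: bH_def)

lemma bH_I: "X \<in> H \<Longrightarrow> (\<And>\<omega>. \<omega> \<in> space M \<Longrightarrow> \<bar>X \<omega>\<bar> \<le> B) \<Longrightarrow> X \<in> bH"
  by (auto simp: bH_def)

lemma bdd_Lip_vec_bH:
  assumes "bdd_Lip (ldist n) \<phi>" "\<And>i. i < n \<Longrightarrow> X i \<in> H"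
  shows "(\<lambda>\<omega>. \<phi> (\<lambda>i. X i \<omega>)) \<in> bH"
proof -
  obtain B where "\<And>x. \<bar>\<phi> x\<bar> \<le> B"
    using assms(1) by (rule bdd_LipE) blast
  then show ?thesis
    using H_C_l_Lip[OF bdd_Lip_imp_C_l_Lip[OF assms(1)] assms(2)] by (intro bH_I)
qed

lemma bdd_Lip_bH:
  assumes "bdd_Lip rdist f" "X \<in> H"
  shows "(\<lambda>\<omega>. f (X \<omega>)) \<in> bH"
  using bdd_Lip_vec_bH[OF bdd_Lip_coordinate[OF assms(1), of 0 1], of "\<lambda>_. X"] assms(2) by simp

lemma bH_const: "(\<lambda>_. c) \<in> bH"
  using bdd_Lip_bH[OF bdd_Lip_const H_zero] .

lemma bH_add:
  assumes "X \<in> bH" "Y \<in> bH"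
  shows "(\<lambda>\<omega>. X \<omega> + Y \<omega>) \<in> bH"
proof -
  obtain B B' where "\<forall>\<omega>\<in>space M. \<bar>X \<omega>\<bar> \<le> B" "\<forall>\<omega>\<in>space M. \<bar>Y \<omega>\<bar> \<le> B'"
    using assms by (auto simp: bH_def)
  then show ?thesis
    using assms by (intro bH_I[where B = "B + B'"] H_add)
      (auto simp: bH_def intro!: order_trans[OF abs_triangle_ineq add_mono])
qed

lemma bH_scale:
  assumes "X \<in> bH"
  shows "(\<lambda>\<omega>. c * X \<omega>) \<in> bH"
proof -
  obtain B where "\<forall>\<omega>\<in>space M. \<bar>X \<omega>\<bar> \<le> B"
    using assms by (auto simp: bH_def)
  then show ?thesis
    using assms by (intro bH_I[where B = "\<bar>c\<bar> * B"] H_scale)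
      (auto simp: bH_def abs_mult intro: mult_left_mono)
qed

lemma bH_sum:
  assumes "\<And>i. i \<in> I \<Longrightarrow> X i \<in> bH"
  shows "(\<lambda>\<omega>. \<Sum>i\<in>I. X i \<omega>) \<in> bH"
  using assms by (induction I rule: infinite_finite_induct) (auto intro: bH_const bH_add)

lemma E_bounds:
  assumes "X \<in> bH" "\<And>\<omega>. \<omega> \<in> space M \<Longrightarrow> \<bar>X \<omega>\<bar> \<le> B"
  shows "ereal (- B) \<le> E X" "E X \<le> ereal B"
proof -
  have "E (\<lambda>_. - B) \<le> E X" "E X \<le> E (\<lambda>_. B)"
    using assms bH_const by (auto intro!: E_mono simp: bH_def abs_le_iff minus_le_iff)
  then show "ereal (- B) \<le> E X" "E X \<le> ereal B" by (simp_all add: E_const)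
qed

lemma E_eq_e:
  assumes "X \<in> bH"
  shows "E X = ereal (e X)"
proof -
  obtain B where "\<forall>\<omega>\<in>space M. \<bar>X \<omega>\<bar> \<le> B" using assms by (auto simp: bH_def)
  then have "ereal (- B) \<le> E X" "E X \<le> ereal B" using E_bounds[OF assms, of B] by auto
  then show ?thesis unfolding e_def by (cases "E X") auto
qed

lemma e_const [simp]: "e (\<lambda>_. c) = c"
  by (simp add: e_def E_const)

lemma e_mono:
  assumes "X \<in> bH" "Y \<in> bH" "\<And>\<omega>. \<omega> \<in> space M \<Longrightarrow> X \<omega> \<le> Y \<omega>"
  shows "e X \<le> e Y"
proof -
  have "E X \<le> E Y" using assms by (intro E_mono) (auto simp: bH_imp_H)
  then show ?thesis using assms by (simp add: E_eq_e)
qed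

lemma e_add_le:
  assumes "X \<in> bH" "Y \<in> bH"
  shows "e (\<lambda>\<omega>. X \<omega> + Y \<omega>) \<le> e X + e Y"
proof -
  have "E (\<lambda>\<omega>. X \<omega> + Y \<omega>) \<le> E X + E Y"
    using assms by (intro E_subadd) (auto simp: bH_imp_H E_eq_e)
  then show ?thesis using assms by (simp add: E_eq_e bH_add)
qed

lemma e_scale:
  assumes "X \<in> bH" "0 \<le> c"
  shows "e (\<lambda>\<omega>. c * X \<omega>) = c * e X"
  using E_pos_homogeneous[OF bH_imp_H[OF assms(1)] assms(2)] assms
  by (simp add: E_eq_e bH_scale)

lemma e_sum_le:
  assumes "\<And>i. i \<in> I \<Longrightarrow> X i \<in> bH"
  shows "e (\<lambda>\<omega>. \<Sum>i\<in>I. X i \<omega>) \<le> (\<Sum>i\<in>I. e (X i))"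
  using assms
proof (induction I rule: infinite_finite_induct)
  case (insert i I)
  then have "e (\<lambda>\<omega>. X i \<omega> + (\<Sum>i\<in>I. X i \<omega>)) \<le> e (X i) + e (\<lambda>\<omega>. \<Sum>i\<in>I. X i \<omega>)"
    by (intro e_add_le bH_sum) auto
  then show ?case using insert by simp
qed auto

lemma e_nonneg:
  assumes "X \<in> bH" "\<And>\<omega>. \<omega> \<in> space M \<Longrightarrow> 0 \<le> X \<omega>"
  shows "0 \<le> e X"
  using e_mono[OF bH_const[of 0] assms(1)] assms(2) by simp

text \<open>Subadditivity replaces linearity: apply it to X <= Z + Y and to Y <= Z + X.\<close>

lemma e_abs_diff_le:
  assumes "X \<in> bH" "Y \<in> bH" "Z \<in> bH"
    and "\<And>\<omega>. \<omega> \<in> space M \<Longrightarrow> \<bar>X \<omega> - Y \<omega>\<bar> \<le> Z \<omega>"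
  shows "\<bar>e X - e Y\<bar> \<le> e Z"
proof -
  have "e X \<le> e (\<lambda>\<omega>. Z \<omega> + Y \<omega>)" "e Y \<le> e (\<lambda>\<omega>. Z \<omega> + X \<omega>)"
    using assms(4) by (auto intro!: e_mono bH_add assms(1-3)) (smt (verit))+
  then show ?thesis
    using e_add_le[OF assms(3,2)] e_add_le[OF assms(3,1)] by linarith
qed

lemma V_hat_nonneg: "0 \<le> V_hat M H E A"
  unfolding V_hat_def
proof (rule Inf_greatest, clarify)
  fix \<xi> assume \<xi>: "\<xi> \<in> H" "\<forall>\<omega>\<in>space M. indicator A \<omega> \<le> \<xi> \<omega>"
  have "E (\<lambda>_. 0) \<le> E \<xi>"
    using \<xi> H_zero by (intro E_mono) (auto intro: order_trans[OF indicator_pos_le])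
  then show "0 \<le> E \<xi>" by (simp add: E_const zero_ereal_def)
qed

lemma V_hat_le:
  assumes "\<xi> \<in> bH" "\<And>\<omega>. \<omega> \<in> space M \<Longrightarrow> indicator A \<omega> \<le> \<xi> \<omega>"
  shows "V_hat M H E A \<le> ereal (e \<xi>)"
  unfolding V_hat_def E_eq_e[OF assms(1), symmetric]
  by (rule Inf_lower) (use assms in \<open>auto simp: bH_imp_H\<close>)

text \<open>The vanishing of \<open>V_hat_star\<close> unfolded into covers of arbitrarily small
  total capacity. In this form subsets and countable unions are handled directly, also for sets that
  are not measurable.\<close>

definition null :: "'a set \<Rightarrow> bool" where
  "null A \<longleftrightarrow> (\<forall>\<epsilon>>0. \<exists>B. range B \<subseteq> sets M \<and> A \<subseteq> (\<Union>n. B n) \<and> (\<Sum>n. V_hat M H E (B n)) \<le> ereal \<epsilon>)"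

lemma null_imp_V_hat_star_eq_0:
  assumes "null A"
  shows "V_hat_star M H E A = 0"
proof (rule antisym)
  show "0 \<le> V_hat_star M H E A"
    unfolding V_hat_star_def
    by (rule Inf_greatest) (auto intro!: suminf_nonneg summable_ereal_pos V_hat_nonneg)
  show "V_hat_star M H E A \<le> 0"
  proof (rule ereal_le_epsilon2)
    fix \<epsilon> :: real assume "0 < \<epsilon>"
    then obtain B where B: "range B \<subseteq> sets M" "A \<subseteq> (\<Union>n. B n)"
        "(\<Sum>n. V_hat M H E (B n)) \<le> ereal \<epsilon>"
      using assms unfolding null_def by metis
    then have "V_hat_star M H E A \<le> (\<Sum>n. V_hat M H E (B n))"
      unfolding V_hat_star_def by (intro Inf_lower) blast
    then show "V_hat_star M H E A \<le> 0 + ereal \<epsilon>" using B(3) by simp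
  qed
qed

lemma null_UN:
  fixes A :: "nat \<Rightarrow> 'a set"
  assumes "\<And>m. null (A m)"
  shows "null (\<Union>m. A m)"
  unfolding null_def
proof (intro allI impI)
  fix \<epsilon> :: real assume \<epsilon>: "0 < \<epsilon>"
  have "\<forall>m. \<exists>B. range B \<subseteq> sets M \<and> A m \<subseteq> (\<Union>n. B n) \<and>
      (\<Sum>n. V_hat M H E (B n)) \<le> ereal (\<epsilon> * (1 / 2) ^ Suc m)"
    using assms \<epsilon> unfolding null_def by simp
  then obtain B where B: "\<And>m. range (B m) \<subseteq> sets M" "\<And>m. A m \<subseteq> (\<Union>n. B m n)"
      "\<And>m. (\<Sum>n. V_hat M H E (B m n)) \<le> ereal (\<epsilon> * (1 / 2) ^ Suc m)"
    by metis
  define C where "C i = case_prod B (prod_decode i)" for i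
  have "(\<Sum>i. V_hat M H E (C i)) \<le> ereal \<epsilon>"
  proof (intro suminf_bound allI)
    fix n
    \<comment> \<open>A pair with code below \<open>n\<close> has both components below
      \<open>n\<close>. So a partial sum of the re-indexed series is bounded by a finite square of
      the double series, and no rearrangement of infinite sums is needed.\<close>
    have K: "prod_decode ` {..<n} \<subseteq> {..<n} \<times> {..<n}"
    proof (rule image_subsetI)
      fix i assume "i \<in> {..<n}"
      then show "prod_decode i \<in> {..<n} \<times> {..<n}"
        using le_prod_encode_1 le_prod_encode_2
        by (cases "prod_decode i") (metis SigmaI lessThan_iff order_le_less_trans prod_decode_inverse)
    qed
    have "(\<Sum>i<n. V_hat M H E (C i)) = (\<Sum>p\<in>prod_decode ` {..<n}. V_hat M H E (case_prod B p))"
      by (subst sum.reindex) (auto simp: C_def inj_on_def)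
    also have "\<dots> \<le> (\<Sum>p\<in>{..<n} \<times> {..<n}. V_hat M H E (case_prod B p))"
      using K by (intro sum_mono2) (auto intro: V_hat_nonneg)
    also have "\<dots> = (\<Sum>m<n. \<Sum>k<n. V_hat M H E (B m k))"
      by (simp add: sum.cartesian_product case_prod_beta)
    also have "\<dots> \<le> (\<Sum>m<n. ereal (\<epsilon> * (1 / 2) ^ Suc m))"
    proof (rule sum_mono)
      fix m
      have "(\<Sum>k<n. V_hat M H E (B m k)) \<le> (\<Sum>k. V_hat M H E (B m k))"
        by (intro sum_le_suminf) (auto intro: V_hat_nonneg summable_ereal_pos)
      then show "(\<Sum>k<n. V_hat M H E (B m k)) \<le> ereal (\<epsilon> * (1 / 2) ^ Suc m)"
        using B(3) order_trans by blast
    qed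
    also have "\<dots> = ereal (\<Sum>m<n. \<epsilon> * (1 / 2) ^ Suc m)" by simp
    also have "(\<Sum>m<n. \<epsilon> * (1 / 2) ^ Suc m) \<le> \<epsilon>"
    proof -
      have "(\<Sum>m<n. \<epsilon> * (1 / 2) ^ Suc m) = \<epsilon> * (1 - (1 / 2) ^ n)"
        by (induction n) (auto simp: algebra_simps)
      then show ?thesis using \<epsilon> by simp
    qed
    finally show "(\<Sum>i<n. V_hat M H E (C i)) \<le> ereal \<epsilon>" by simp
  qed (rule V_hat_nonneg)
  moreover have "range C \<subseteq> sets M"
    using B(1) by (auto simp: C_def split: prod.split)
  moreover have "(\<Union>m. A m) \<subseteq> (\<Union>i. C i)"
  proof safe
    fix x m assume "x \<in> A m"
    then obtain n where "x \<in> B m n" using B(2) by blast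
    then have "x \<in> C (prod_encode (m, n))" by (simp add: C_def)
    then show "x \<in> (\<Union>i. C i)" by blast
  qed
  ultimately show "\<exists>B. range B \<subseteq> sets M \<and> (\<Union>m. A m) \<subseteq> (\<Union>n. B n) \<and>
      (\<Sum>n. V_hat M H E (B n)) \<le> ereal \<epsilon>"
    by blast
qed

lemma null_mono: "null B \<Longrightarrow> A \<subseteq> B \<Longrightarrow> null A"
  unfolding null_def by (meson order_trans)

lemma null_Un: "null A \<Longrightarrow> null B \<Longrightarrow> null (A \<union> B)"
  using null_UN[of "\<lambda>m. if m = 0 then A else B"] by (rule null_mono) (auto split: if_splits)

lemma null_empty: "null {}"
  unfolding null_def
proof (intro allI impI)
  fix \<epsilon> :: real assume "0 < \<epsilon>"
  have "V_hat M H E {} \<le> 0" using V_hat_le[OF bH_const[of 0], of "{}"] by (simp add: zero_ereal_def)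
  then have "V_hat M H E {} = 0" using V_hat_nonneg[of "{}"] by (rule antisym)
  then show "\<exists>B. range B \<subseteq> sets M \<and> {} \<subseteq> (\<Union>n. B n) \<and> (\<Sum>n. V_hat M H E (B n)) \<le> ereal \<epsilon>"
    using \<open>0 < \<epsilon>\<close> by (intro exI[of _ "\<lambda>_. {}"]) auto
qed

text \<open>The tails of the sequence \<open>D\<close> serve as the covers required by
  \<open>null\<close>; their total capacity is a tail of the summable series
  \<open>v\<close>.\<close>

lemma borel_cantelli:
  fixes v :: "nat \<Rightarrow> real"
  assumes "summable v" "\<And>k. D k \<in> sets M"
    and "\<forall>\<^sub>F k in sequentially. V_hat M H E (D k) \<le> ereal (v k)"
    and "\<And>K. A \<subseteq> (\<Union>k\<in>{K..}. D k)"
  shows "null A"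
  unfolding null_def
proof (intro allI impI)
  fix \<epsilon> :: real assume \<epsilon>: "0 < \<epsilon>"
  obtain K where K: "\<And>k. k \<ge> K \<Longrightarrow> V_hat M H E (D k) \<le> ereal (v k)"
    using assms(3) by (auto simp: eventually_sequentially)
  have v: "0 \<le> v k" if "k \<ge> K" for k
    using order_trans[OF V_hat_nonneg K[OF that]] by simp
  obtain N where "\<forall>n\<ge>N. norm (\<Sum>i. v (i + n)) < \<epsilon>"
    using suminf_exist_split[OF \<epsilon> assms(1)] by blast
  then have "norm (\<Sum>i. v (i + max N K)) < \<epsilon>" by simp
  then have tail: "(\<Sum>i. v (i + max N K)) < \<epsilon>" by simp
  have s: "summable (\<lambda>i. v (i + max N K))" using assms(1) by (simp add: summable_iff_shift)
  let ?C = "\<lambda>i. D (i + max N K)"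
  have "(\<Sum>i. V_hat M H E (?C i)) \<le> ereal \<epsilon>"
  proof (intro suminf_bound allI)
    fix n
    have "(\<Sum>i<n. V_hat M H E (?C i)) \<le> (\<Sum>i<n. ereal (v (i + max N K)))"
      by (intro sum_mono K) auto
    also have "\<dots> = ereal (\<Sum>i<n. v (i + max N K))" by simp
    also have "\<dots> \<le> ereal (\<Sum>i. v (i + max N K))"
      unfolding ereal_less_eq using s v by (intro sum_le_suminf) auto
    also have "\<dots> \<le> ereal \<epsilon>" using tail by simp
    finally show "(\<Sum>i<n. V_hat M H E (?C i)) \<le> ereal \<epsilon>" .
  qed (rule V_hat_nonneg)
  moreover have "A \<subseteq> (\<Union>i. ?C i)"
  proof
    fix x assume "x \<in> A"
    then obtain k where k: "k \<ge> max N K" "x \<in> D k" using assms(4)[of "max N K"] by auto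
    then have "x \<in> ?C (k - max N K)" by simp
    then show "x \<in> (\<Union>i. ?C i)" by blast
  qed
  moreover have "range ?C \<subseteq> sets M" using assms(2) by blast
  ultimately show "\<exists>B. range B \<subseteq> sets M \<and> A \<subseteq> (\<Union>n. B n) \<and> (\<Sum>n. V_hat M H E (B n)) \<le> ereal \<epsilon>"
    by blast
qed

end

section \<open>Maximal inequality\<close>

text \<open>This isolates the consequences of the hypotheses that the limit theorem consumes.
  Independence is one-sided: a Lipschitz majorant of the partial expectation may replace the
  integrand. The capacity and the Choquet integral survive only as \<open>tail_summable\<close>. The
  whole list is stable under reflection of \<open>Y\<close>, which yields the lower limit.\<close>

locale iid_space = sublinear_expectation_space +
  fixes Y :: "nat \<Rightarrow> 'a \<Rightarrow> real"
  assumes Y_H: "1 \<le> i \<Longrightarrow> Y i \<in> H"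
    and ident: "bdd_Lip rdist f \<Longrightarrow> 1 \<le> i \<Longrightarrow> E (\<lambda>\<omega>. f (Y i \<omega>)) = E (\<lambda>\<omega>. f (Y 1 \<omega>))"
    and indep: "1 \<le> k \<Longrightarrow> bdd_Lip (ldist (Suc k)) \<phi> \<Longrightarrow> bdd_Lip (ldist k) \<psi> \<Longrightarrow>
        (\<And>x. E (\<lambda>\<omega>. \<phi> (x(k := Y (Suc k) \<omega>))) \<le> ereal (\<psi> x)) \<Longrightarrow>
        E (\<lambda>\<omega>. \<phi> (\<lambda>j. Y (Suc j) \<omega>)) \<le> E (\<lambda>\<omega>. \<psi> (\<lambda>j. Y (Suc j) \<omega>))"
    and tail_summable: "1 < l \<Longrightarrow> 0 < \<kappa> \<Longrightarrow>
        summable (\<lambda>j. l ^ j * e (\<lambda>\<omega>. hat (\<kappa> * sqrt (l ^ j * LL (l ^ j))) (Y 1 \<omega>)))"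

lemma bdd_Lip_fun_upd:
  assumes "bdd_Lip (ldist (Suc k)) \<phi>"
  shows "bdd_Lip rdist (\<lambda>y. \<phi> (x(k := y)))"
proof -
  obtain B L where f: "\<And>x. \<bar>\<phi> x\<bar> \<le> B" "\<And>x y. \<bar>\<phi> x - \<phi> y\<bar> \<le> L * ldist (Suc k) x y"
    using assms(1) by (rule bdd_LipE) blast
  show ?thesis
  proof (rule bdd_LipI)
    show "\<bar>\<phi> (x(k := y))\<bar> \<le> B" for y by (rule f)
    show "\<bar>\<phi> (x(k := y)) - \<phi> (x(k := z))\<bar> \<le> L * \<bar>y - z\<bar>" for y z
      using f(2)[of "x(k := y)" "x(k := z)"] by simp
  qed
qed

text \<open>With \<open>F z = exp (h * (clip b z - \<mu>)) / K\<close> this is the exponential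
  supermartingale; \<open>F\<close> is kept general because only nonnegativity and mean at most 1
  matter for it.\<close>

definition walk :: "(real \<Rightarrow> real) \<Rightarrow> (nat \<Rightarrow> real) \<Rightarrow> nat \<Rightarrow> real" where
  "walk F x k = (\<Prod>j<k. F (x j))"

text \<open>
  A Lipschitz substitute for the indicator of the event that the walk has not yet reached the level
  \<open>\<Lambda>\<close>; \<open>stopped\<close> is the correspondingly stopped walk.
\<close>

primrec alive :: "(real \<Rightarrow> real) \<Rightarrow> real \<Rightarrow> (nat \<Rightarrow> real) \<Rightarrow> nat \<Rightarrow> real" where
  "alive F \<Lambda> x 0 = 1"
| "alive F \<Lambda> x (Suc k) = alive F \<Lambda> x k * (1 - hat \<Lambda> (walk F x (Suc k)))"

primrec stopped :: "(real \<Rightarrow> real) \<Rightarrow> real \<Rightarrow> (nat \<Rightarrow> real) \<Rightarrow> nat \<Rightarrow> real" where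
  "stopped F \<Lambda> x 0 = 1"
| "stopped F \<Lambda> x (Suc k) = stopped F \<Lambda> x k + alive F \<Lambda> x k * (walk F x (Suc k) - walk F x k)"

lemma walk_Suc: "walk F x (Suc k) = walk F x k * F (x k)"
  by (simp add: walk_def)

lemma alive_bounds: "0 \<le> alive F \<Lambda> x k" "alive F \<Lambda> x k \<le> 1"
  by (induction k) (use hat_bounds in \<open>auto simp: mult_le_one\<close>)

lemma alive_eq_0:
  assumes "0 < \<Lambda>" "1 \<le> j" "j \<le> n" "\<Lambda> \<le> walk F x j"
  shows "alive F \<Lambda> x n = 0"
  using assms(3)
proof (induction n)
  case 0
  then show ?case using assms by simp
next
  case (Suc n)
  show ?case
  proof (cases "j = Suc n")
    case True
    then have "hat \<Lambda> (walk F x (Suc n)) = 1" using assms by (intro hat_eq_1) auto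
    then show ?thesis by simp
  next
    case False
    then show ?thesis using Suc by simp
  qed
qed

text \<open>The function \<open>hat \<Lambda>\<close> vanishes below \<open>\<Lambda> / 2\<close>,
  so each portion of \<open>alive\<close> that is lost is lost at a walk value of at least
  \<open>\<Lambda> / 2\<close>. This half is the origin of the factor 2 in the maximal
  inequality.\<close>

lemma stopped_ge:
  assumes "0 < \<Lambda>" "\<And>y. 0 \<le> F y"
  shows "alive F \<Lambda> x k * walk F x k + \<Lambda> / 2 * (1 - alive F \<Lambda> x k) \<le> stopped F \<Lambda> x k"
proof (induction k)
  case (Suc k)
  let ?D = "alive F \<Lambda> x k" and ?W = "walk F x (Suc k)"
  let ?g = "hat \<Lambda> ?W"
  have W: "0 \<le> ?W" unfolding walk_def by (intro prod_nonneg) (use assms in auto)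
  have "0 \<le> ?g * (?W - \<Lambda> / 2)"
  proof (cases "?W \<le> \<Lambda> / 2")
    case True
    then have "?g = 0" using W assms(1) by (intro hat_eq_0) auto
    then show ?thesis by simp
  next
    case False
    then show ?thesis using hat_bounds[of \<Lambda>] by (intro mult_nonneg_nonneg) auto
  qed
  then have "0 \<le> ?D * (?g * (?W - \<Lambda> / 2))"
    by (rule mult_nonneg_nonneg[OF alive_bounds(1)])
  then show ?case using Suc by (simp add: algebra_simps)
qed (simp add: walk_def)

lemma bdd_Lip_walk:
  assumes "bdd_Lip rdist F" "k \<le> n"
  shows "bdd_Lip (ldist n) (\<lambda>x. walk F x k)"
  using assms(2)
proof (induction k)
  case (Suc k)
  then have "bdd_Lip (ldist n) (\<lambda>x. walk F x k * F (x k))"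
    by (intro bdd_Lip_mult bdd_Lip_coordinate[OF assms(1)]) auto
  then show ?case by (simp add: walk_Suc)
qed (simp add: walk_def bdd_Lip_const)

lemma bdd_Lip_alive:
  assumes "bdd_Lip rdist F" "0 < \<Lambda>" "k \<le> n"
  shows "bdd_Lip (ldist n) (\<lambda>x. alive F \<Lambda> x k)"
  using assms(3)
proof (induction k)
  case (Suc k)
  have "bdd_Lip (ldist n) (\<lambda>x. hat \<Lambda> (walk F x (Suc k)))"
  proof (rule bdd_Lip_contraction[OF bdd_Lip_walk[OF assms(1) Suc.prems]])
    show "0 \<le> 2 / \<Lambda>" using assms(2) by simp
    show "\<bar>hat \<Lambda> x - hat \<Lambda> y\<bar> \<le> 2 / \<Lambda> * \<bar>x - y\<bar>" for x y
      by (rule hat_lipschitz[OF assms(2)])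
  qed
  then show ?case using Suc by (auto intro!: bdd_Lip_mult bdd_Lip_diff bdd_Lip_const)
qed (simp add: bdd_Lip_const)

lemma bdd_Lip_stopped:
  assumes "bdd_Lip rdist F" "0 < \<Lambda>" "k \<le> n"
  shows "bdd_Lip (ldist n) (\<lambda>x. stopped F \<Lambda> x k)"
  using assms(3)
proof (induction k)
  case (Suc k)
  then show ?case
    using bdd_Lip_walk[OF assms(1)] bdd_Lip_alive[OF assms(1,2)]
    by (auto intro!: bdd_Lip_add bdd_Lip_mult bdd_Lip_diff)
qed (simp add: bdd_Lip_const)

section \<open>Supermartingale property of the stopped walk, maximal inequality and exponential
  moments\<close>

context iid_space
begin

lemma f_Y_bH: "bdd_Lip rdist f \<Longrightarrow> 1 \<le> i \<Longrightarrow> (\<lambda>\<omega>. f (Y i \<omega>)) \<in> bH"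
  by (intro bdd_Lip_bH Y_H)

lemma vec_Y_bH: "bdd_Lip (ldist n) \<phi> \<Longrightarrow> (\<lambda>\<omega>. \<phi> (\<lambda>j. Y (Suc j) \<omega>)) \<in> bH"
  by (rule bdd_Lip_vec_bH) (auto intro: Y_H)

lemma e_f_Y: "bdd_Lip rdist f \<Longrightarrow> 1 \<le> i \<Longrightarrow> e (\<lambda>\<omega>. f (Y i \<omega>)) = e (\<lambda>\<omega>. f (Y 1 \<omega>))"
  unfolding e_def by (rule arg_cong[OF ident])

lemma e_step:
  assumes \<phi>: "bdd_Lip (ldist (Suc k)) \<phi>" and \<psi>: "bdd_Lip (ldist k) \<psi>"
    and le: "\<And>x. e (\<lambda>\<omega>. \<phi> (x(k := Y (Suc k) \<omega>))) \<le> \<psi> x"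
  shows "e (\<lambda>\<omega>. \<phi> (\<lambda>j. Y (Suc j) \<omega>)) \<le> e (\<lambda>\<omega>. \<psi> (\<lambda>j. Y (Suc j) \<omega>))"
proof (cases "k = 0")
  \<comment> \<open>Independence is available from \<open>k = 1\<close> on. With an empty past,
    \<open>\<phi>\<close> depends on one coordinate and \<open>\<psi>\<close> is constant, so the
    assumption at a single point suffices.\<close>
  case True
  have "\<phi> (\<lambda>j. Y (Suc j) \<omega>) = \<phi> ((\<lambda>_. 0)(0 := Y (Suc 0) \<omega>))" for \<omega>
    by (rule bdd_Lip_cong_coordinates[OF \<phi>]) (use True in auto)
  moreover have "\<psi> (\<lambda>j. Y (Suc j) \<omega>) = \<psi> (\<lambda>_. 0)" for \<omega>
    by (rule bdd_Lip_cong_coordinates[OF \<psi>]) (use True in auto)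
  ultimately show ?thesis using le[of "\<lambda>_. 0"] True by simp
next
  case False
  have "E (\<lambda>\<omega>. \<phi> (\<lambda>j. Y (Suc j) \<omega>)) \<le> E (\<lambda>\<omega>. \<psi> (\<lambda>j. Y (Suc j) \<omega>))"
  proof (rule indep[OF _ \<phi> \<psi>])
    fix x
    have "(\<lambda>\<omega>. \<phi> (x(k := Y (Suc k) \<omega>))) \<in> bH"
      using f_Y_bH[OF bdd_Lip_fun_upd[OF \<phi>]] by simp
    then show "E (\<lambda>\<omega>. \<phi> (x(k := Y (Suc k) \<omega>))) \<le> ereal (\<psi> x)"
      using le[of x] by (simp add: E_eq_e)
  qed (use False in simp)
  then show ?thesis
    using vec_Y_bH[OF \<phi>] vec_Y_bH[OF \<psi>] by (simp add: E_eq_e)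
qed

text \<open>For a fixed past the next increment is \<open>c * (F - 1)\<close> with \<open>c\<close>
  the alive part of the walk. Positive homogeneity needs \<open>0 \<le> c\<close>, and the mean of
  \<open>F\<close> at most 1 makes the increment nonpositive in expectation.\<close>

lemma e_stopped_le:
  assumes F: "bdd_Lip rdist F" "\<And>y. 0 \<le> F y" "e (\<lambda>\<omega>. F (Y 1 \<omega>)) \<le> 1" and \<Lambda>: "0 < \<Lambda>"
  shows "e (\<lambda>\<omega>. stopped F \<Lambda> (\<lambda>j. Y (Suc j) \<omega>) k) \<le> 1"
proof (induction k)
  case (Suc k)
  have "e (\<lambda>\<omega>. stopped F \<Lambda> (\<lambda>j. Y (Suc j) \<omega>) (Suc k)) \<le> e (\<lambda>\<omega>. stopped F \<Lambda> (\<lambda>j. Y (Suc j) \<omega>) k)"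
  proof (rule e_step)
    show "bdd_Lip (ldist (Suc k)) (\<lambda>x. stopped F \<Lambda> x (Suc k))"
      by (rule bdd_Lip_stopped[OF F(1) \<Lambda>]) simp
    show \<psi>: "bdd_Lip (ldist k) (\<lambda>x. stopped F \<Lambda> x k)"
      by (rule bdd_Lip_stopped[OF F(1) \<Lambda>]) simp
    fix x :: "nat \<Rightarrow> real"
    define c where "c = alive F \<Lambda> x k * walk F x k"
    have c: "0 \<le> c"
      unfolding c_def walk_def
      by (intro mult_nonneg_nonneg alive_bounds prod_nonneg) (use F(2) in auto)
    have "walk F (x(k := y)) k = walk F x k" for y
      by (rule bdd_Lip_cong_coordinates[OF bdd_Lip_walk[OF F(1) order_refl]]) simp
    moreover have "alive F \<Lambda> (x(k := y)) k = alive F \<Lambda> x k" for y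
      by (rule bdd_Lip_cong_coordinates[OF bdd_Lip_alive[OF F(1) \<Lambda> order_refl]]) simp
    moreover have "stopped F \<Lambda> (x(k := y)) k = stopped F \<Lambda> x k" for y
      by (rule bdd_Lip_cong_coordinates[OF \<psi>]) simp
    ultimately have "(\<lambda>\<omega>. stopped F \<Lambda> (x(k := Y (Suc k) \<omega>)) (Suc k)) =
        (\<lambda>\<omega>. (stopped F \<Lambda> x k - c) + c * F (Y (Suc k) \<omega>))"
      by (simp add: walk_Suc c_def algebra_simps)
    moreover have FY: "(\<lambda>\<omega>. F (Y (Suc k) \<omega>)) \<in> bH" by (rule f_Y_bH[OF F(1)]) simp
    then have "e (\<lambda>\<omega>. (stopped F \<Lambda> x k - c) + c * F (Y (Suc k) \<omega>)) \<le>
        (stopped F \<Lambda> x k - c) + c * e (\<lambda>\<omega>. F (Y (Suc k) \<omega>))"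
      using e_add_le[OF bH_const bH_scale[OF FY, of c], of "stopped F \<Lambda> x k - c"]
      by (simp add: e_scale[OF FY c])
    moreover have "c * e (\<lambda>\<omega>. F (Y (Suc k) \<omega>)) \<le> c * 1"
      using e_f_Y[OF F(1), of "Suc k"] F(3) c by (intro mult_left_mono) auto
    ultimately show "e (\<lambda>\<omega>. stopped F \<Lambda> (x(k := Y (Suc k) \<omega>)) (Suc k)) \<le> stopped F \<Lambda> x k"
      by simp
  qed
  then show ?case using Suc by linarith
qed simp

text \<open>A Chebyshev bound with the test function \<open>\<xi>\<close>. If some variable reaches
  the clipping level, the sum of the hats is at least 1; otherwise the clipped and original sums
  agree, and crossing \<open>y\<close> forces the walk above \<open>\<Lambda>\<close>, so that the
  stopped walk ends at \<open>\<Lambda> / 2\<close> or more.\<close>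

lemma maximal_inequality:
  fixes b h K y \<mu> :: real
  assumes "0 < b" "0 \<le> h" "1 \<le> K"
    and moment: "e (\<lambda>\<omega>. exp (h * (clip b (Y 1 \<omega>) - \<mu>))) \<le> K"
  shows "V_hat M H E {\<omega> \<in> space M. \<exists>j\<in>{1..n}. y < (\<Sum>i=1..j. Y i \<omega> - \<mu>)}
      \<le> ereal (2 * K ^ n * exp (- (h * y)) + real n * e (\<lambda>\<omega>. hat b (Y 1 \<omega>)))"
proof -
  define F where "F z = 1 / K * exp (h * (clip b z - \<mu>))" for z
  \<comment> \<open>A crossing of \<open>y\<close> at time \<open>j\<close> puts the walk at
    \<open>exp (h * y) / K ^ j\<close> or higher. Since \<open>1 \<le> K\<close>, this level with
    \<open>n\<close> in place of \<open>j\<close> works for all times up to \<open>n\<close> at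
    once.\<close>
  define \<Lambda> where "\<Lambda> = exp (h * y) / K ^ n"
  define Q where "Q \<omega> = stopped F \<Lambda> (\<lambda>j. Y (Suc j) \<omega>) n" for \<omega>
  define \<xi> where "\<xi> \<omega> = 2 / \<Lambda> * Q \<omega> + (\<Sum>i=1..n. hat b (Y i \<omega>))" for \<omega>
  have \<Lambda>: "0 < \<Lambda>" using assms by (simp add: \<Lambda>_def)
  have ex: "bdd_Lip rdist (\<lambda>z. exp (h * (clip b z - \<mu>)))"
    by (intro bdd_Lip_exp bdd_Lip_mult bdd_Lip_diff bdd_Lip_const bdd_Lip_clip)
  have F: "bdd_Lip rdist F" unfolding F_def by (intro bdd_Lip_mult bdd_Lip_const ex)
  have F0: "0 \<le> F z" for z using assms(3) by (simp add: F_def)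
  have "e (\<lambda>\<omega>. F (Y 1 \<omega>)) \<le> 1"
    unfolding F_def using e_scale[OF f_Y_bH[OF ex, of 1], of "1 / K"] moment assms(3)
    by simp
  then have eQ: "e Q \<le> 1" unfolding Q_def by (rule e_stopped_le[OF F F0 _ \<Lambda>])
  have hatY: "(\<lambda>\<omega>. hat b (Y i \<omega>)) \<in> bH" if "i \<in> {1..n}" for i
    using that by (intro f_Y_bH bdd_Lip_hat assms) auto
  have hatS: "(\<lambda>\<omega>. \<Sum>i=1..n. hat b (Y i \<omega>)) \<in> bH" by (intro bH_sum hatY)
  have Q: "Q \<in> bH" unfolding Q_def by (rule vec_Y_bH[OF bdd_Lip_stopped[OF F \<Lambda> order_refl]])
  have \<xi>: "\<xi> \<in> bH" unfolding \<xi>_def by (intro bH_add bH_scale Q hatS)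
  have "e \<xi> \<le> e (\<lambda>\<omega>. 2 / \<Lambda> * Q \<omega>) + e (\<lambda>\<omega>. \<Sum>i=1..n. hat b (Y i \<omega>))"
    unfolding \<xi>_def by (rule e_add_le[OF bH_scale[OF Q] hatS])
  also have "e (\<lambda>\<omega>. 2 / \<Lambda> * Q \<omega>) = 2 / \<Lambda> * e Q"
    by (rule e_scale[OF Q]) (use \<Lambda> in simp)
  also have "\<dots> \<le> 2 / \<Lambda> * 1"
    by (rule mult_left_mono[OF eQ]) (use \<Lambda> in simp)
  also have "e (\<lambda>\<omega>. \<Sum>i=1..n. hat b (Y i \<omega>)) \<le> (\<Sum>i=1..n. e (\<lambda>\<omega>. hat b (Y i \<omega>)))"
    by (rule e_sum_le[OF hatY])
  also have "(\<Sum>i=1..n. e (\<lambda>\<omega>. hat b (Y i \<omega>))) = (\<Sum>i=1..n. e (\<lambda>\<omega>. hat b (Y 1 \<omega>)))"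
    by (intro sum.cong refl e_f_Y[OF bdd_Lip_hat[OF assms(1)]]) simp
  also have "2 / \<Lambda> * 1 = 2 * K ^ n * exp (- (h * y))"
    by (simp add: \<Lambda>_def exp_minus field_simps)
  finally have e\<xi>: "e \<xi> \<le> 2 * K ^ n * exp (- (h * y)) + real n * e (\<lambda>\<omega>. hat b (Y 1 \<omega>))"
    by simp
  have Q_ge: "alive F \<Lambda> (\<lambda>j. Y (Suc j) \<omega>) n * walk F (\<lambda>j. Y (Suc j) \<omega>) n
      + \<Lambda> / 2 * (1 - alive F \<Lambda> (\<lambda>j. Y (Suc j) \<omega>) n) \<le> Q \<omega>" for \<omega>
    unfolding Q_def by (rule stopped_ge[OF \<Lambda> F0])
  have Q0: "0 \<le> Q \<omega>" for \<omega>
    by (rule order_trans[OF _ Q_ge])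
       (use \<Lambda> alive_bounds F0 in \<open>auto simp: walk_def intro!: add_nonneg_nonneg mult_nonneg_nonneg prod_nonneg\<close>)
  have "1 \<le> \<xi> \<omega>" if j: "j \<in> {1..n}" and gt: "y < (\<Sum>i=1..j. Y i \<omega> - \<mu>)" for \<omega> j
  proof (cases "\<exists>i\<in>{1..n}. b \<le> \<bar>Y i \<omega>\<bar>")
    case True
    then obtain i where i: "i \<in> {1..n}" "b \<le> \<bar>Y i \<omega>\<bar>" by blast
    have "1 = hat b (Y i \<omega>)" using hat_eq_1[OF assms(1) i(2)] by simp
    also have "\<dots> \<le> (\<Sum>i=1..n. hat b (Y i \<omega>))"
      by (rule member_le_sum) (use i hat_bounds in auto)
    finally show ?thesis unfolding \<xi>_def using Q0[of \<omega>] \<Lambda> by (simp add: add_increasing)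
  next
    case False
    have "walk F (\<lambda>j. Y (Suc j) \<omega>) j = (\<Prod>i<j. 1 / K * exp (h * (Y (Suc i) \<omega> - \<mu>)))"
      unfolding walk_def F_def
    proof (intro prod.cong refl)
      fix i assume "i \<in> {..<j}"
      then have "Suc i \<in> {1..n}" using j by auto
      then have "\<bar>Y (Suc i) \<omega>\<bar> \<le> b" using False by (meson linear)
      then show "1 / K * exp (h * (clip b (Y (Suc i) \<omega>) - \<mu>)) = 1 / K * exp (h * (Y (Suc i) \<omega> - \<mu>))"
        by (simp add: clip_eq_self)
    qed
    also have "\<dots> = (1 / K) ^ j * exp (\<Sum>i<j. h * (Y (Suc i) \<omega> - \<mu>))"
      by (simp only: prod.distrib prod_constant card_lessThan exp_sum[OF finite_lessThan])
    also have "(\<Sum>i<j. h * (Y (Suc i) \<omega> - \<mu>)) = h * (\<Sum>i=1..j. Y i \<omega> - \<mu>)"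
      by (simp add: sum_distrib_left sum.atLeast1_atMost_eq)
    finally have W: "walk F (\<lambda>j. Y (Suc j) \<omega>) j = (1 / K) ^ j * exp (h * (\<Sum>i=1..j. Y i \<omega> - \<mu>))" .
    have "\<Lambda> = (1 / K) ^ n * exp (h * y)" by (simp add: \<Lambda>_def power_divide)
    also have "\<dots> \<le> (1 / K) ^ j * exp (h * (\<Sum>i=1..j. Y i \<omega> - \<mu>))"
      using j gt assms(2,3) by (intro mult_mono power_decreasing) (auto intro: mult_left_mono)
    finally have "alive F \<Lambda> (\<lambda>j. Y (Suc j) \<omega>) n = 0"
      using j W by (intro alive_eq_0[OF \<Lambda>, of j]) auto
    then have "\<Lambda> / 2 \<le> Q \<omega>" using Q_ge[of \<omega>] by simp
    then have "1 \<le> 2 / \<Lambda> * Q \<omega>" using \<Lambda> by (simp add: field_simps)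
    moreover have "0 \<le> (\<Sum>i=1..n. hat b (Y i \<omega>))" by (intro sum_nonneg hat_bounds)
    ultimately show ?thesis unfolding \<xi>_def by linarith
  qed
  moreover have "0 \<le> \<xi> \<omega>" for \<omega>
    unfolding \<xi>_def using Q0[of \<omega>] \<Lambda> hat_bounds
    by (intro add_nonneg_nonneg mult_nonneg_nonneg sum_nonneg) auto
  ultimately have "V_hat M H E {\<omega> \<in> space M. \<exists>j\<in>{1..n}. y < (\<Sum>i=1..j. Y i \<omega> - \<mu>)} \<le> ereal (e \<xi>)"
    by (intro V_hat_le[OF \<xi>]) (auto simp: indicator_def)
  also have "\<dots> \<le> ereal (2 * K ^ n * exp (- (h * y)) + real n * e (\<lambda>\<omega>. hat b (Y 1 \<omega>)))"
    using e\<xi> by simp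
  finally show ?thesis .
qed

abbreviation trunc :: "real \<Rightarrow> real \<Rightarrow> 'a \<Rightarrow> real" where
  "trunc \<mu> b \<omega> \<equiv> clip b (Y 1 \<omega>) - \<mu>"

lemma trunc_power_bH: "(\<lambda>\<omega>. trunc \<mu> b \<omega> ^ p) \<in> bH"
  by (rule f_Y_bH[of "\<lambda>y. (clip b y - \<mu>) ^ p" 1])
     (intro bdd_Lip_power bdd_Lip_diff bdd_Lip_const bdd_Lip_clip, simp)

lemma trunc_bH: "trunc \<mu> b \<in> bH"
  using trunc_power_bH[where p = 1] by simp

text \<open>The clipped and centred variable is at most \<open>2 * b\<close> in absolute value,
  which turns the exponential in the quartic term into a constant. All coefficients of powers are
  nonnegative, so the sublinear \<open>e\<close> may be applied term by term.\<close>

lemma exp_moment_bound: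
  fixes b h \<eta> \<mu> :: real
  assumes "\<bar>\<mu>\<bar> \<le> b" "0 \<le> h" "0 < \<eta>"
  shows "e (\<lambda>\<omega>. exp (h * trunc \<mu> b \<omega>)) \<le> 1 + h * e (trunc \<mu> b)
      + exp \<eta> * h\<^sup>2 / 2 * e (\<lambda>\<omega>. (trunc \<mu> b \<omega>)\<^sup>2)
      + (h / \<eta>) ^ 4 * exp (2 * h * b) * e (\<lambda>\<omega>. trunc \<mu> b \<omega> ^ 4)"
proof -
  let ?Z = "trunc \<mu> b"
  let ?c2 = "exp \<eta> * h\<^sup>2 / 2" and ?c4 = "(h / \<eta>) ^ 4 * exp (2 * h * b)"
  have Z: "\<bar>?Z \<omega>\<bar> \<le> 2 * b" for \<omega>
    using abs_clip_le[of b "Y 1 \<omega>"] assms(1) by linarith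
  have c: "0 \<le> ?c2" "0 \<le> ?c4" using assms by auto
  have "exp (h * z) \<le> ((1 + h * z) + ?c2 * z\<^sup>2) + ?c4 * z ^ 4" if "\<bar>z\<bar> \<le> 2 * b" for z
  proof -
    have "\<bar>h * z\<bar> \<le> 2 * h * b"
      using mult_left_mono[OF that assms(2)] assms(2) by (simp add: abs_mult mult_ac)
    then have "(h * z / \<eta>) ^ 4 * exp \<bar>h * z\<bar> \<le> (h * z / \<eta>) ^ 4 * exp (2 * h * b)"
      by (intro mult_left_mono) auto
    moreover have "(h * z / \<eta>) ^ 4 * exp (2 * h * b) = ?c4 * z ^ 4"
      by (simp add: power_mult_distrib power_divide)
    moreover have "exp \<eta> * (h * z)\<^sup>2 / 2 = ?c2 * z\<^sup>2"
      by (simp add: power_mult_distrib)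
    ultimately show ?thesis
      using exp_le_quadratic_plus_quartic[OF assms(3), of "h * z"] by linarith
  qed
  note pt = this[OF Z]
  have bH1: "(\<lambda>\<omega>. 1 + h * ?Z \<omega>) \<in> bH" by (intro bH_add bH_const bH_scale trunc_bH)
  have bH2: "(\<lambda>\<omega>. (1 + h * ?Z \<omega>) + ?c2 * (?Z \<omega>)\<^sup>2) \<in> bH"
    by (intro bH_add bH1 bH_scale trunc_power_bH)
  have "e (\<lambda>\<omega>. exp (h * ?Z \<omega>)) \<le> e (\<lambda>\<omega>. ((1 + h * ?Z \<omega>) + ?c2 * (?Z \<omega>)\<^sup>2) + ?c4 * ?Z \<omega> ^ 4)"
  proof (rule e_mono[OF _ _ pt])
    show "(\<lambda>\<omega>. exp (h * ?Z \<omega>)) \<in> bH"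
      by (rule f_Y_bH[of "\<lambda>y. exp (h * (clip b y - \<mu>))" 1])
         (intro bdd_Lip_exp bdd_Lip_mult bdd_Lip_diff bdd_Lip_const bdd_Lip_clip, simp)
  qed (intro bH_add bH2 bH_scale trunc_power_bH)
  also have "\<dots> \<le> e (\<lambda>\<omega>. (1 + h * ?Z \<omega>) + ?c2 * (?Z \<omega>)\<^sup>2) + ?c4 * e (\<lambda>\<omega>. ?Z \<omega> ^ 4)"
    using e_add_le[OF bH2 bH_scale[OF trunc_power_bH[where p = 4], of ?c4]]
    by (simp only: e_scale[OF trunc_power_bH c(2)])
  also have "e (\<lambda>\<omega>. (1 + h * ?Z \<omega>) + ?c2 * (?Z \<omega>)\<^sup>2) \<le> e (\<lambda>\<omega>. 1 + h * ?Z \<omega>) + ?c2 * e (\<lambda>\<omega>. (?Z \<omega>)\<^sup>2)"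
    using e_add_le[OF bH1 bH_scale[OF trunc_power_bH[where p = 2], of ?c2]]
    by (simp only: e_scale[OF trunc_power_bH c(1)])
  also have "e (\<lambda>\<omega>. 1 + h * ?Z \<omega>) \<le> 1 + h * e ?Z"
    using e_add_le[OF bH_const bH_scale[OF trunc_bH], of 1 h]
    by (simp only: e_const e_scale[OF trunc_bH assms(2)])
  finally show ?thesis by simp
qed

end

section \<open>Clipping at geometric levels\<close>

definition lev :: "real \<Rightarrow> real \<Rightarrow> nat \<Rightarrow> real" where
  "lev l \<kappa> k = \<kappa> * sqrt (l ^ k * LL (l ^ k))"

context
  fixes l \<kappa> :: real
  assumes l: "1 < l" and \<kappa>: "0 < \<kappa>"
begin

lemma lev_pos: "0 < lev l \<kappa> k"
  unfolding lev_def using l \<kappa> LL_pos by (intro mult_pos_pos) auto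

lemma lev_square: "(lev l \<kappa> k)\<^sup>2 = \<kappa>\<^sup>2 * (l ^ k * LL (l ^ k))"
  unfolding lev_def power_mult_distrib using l LL_pos[of "l ^ k"] by simp

lemma LL_power_mono: "k \<le> j \<Longrightarrow> LL (l ^ k) \<le> LL (l ^ j)"
  using l by (intro LL_mono power_increasing) auto

lemma lev_mono:
  assumes "k \<le> j"
  shows "lev l \<kappa> k \<le> lev l \<kappa> j"
  unfolding lev_def using l \<kappa> LL_power_mono[OF assms] LL_pos[of "l ^ k"] assms
  by (intro mult_left_mono real_sqrt_le_mono mult_mono power_increasing) auto

lemma eventually_lev_ge: "\<forall>\<^sub>F k in sequentially. c \<le> lev l \<kappa> k"
proof -
  have "\<forall>\<^sub>F k in sequentially. (c / \<kappa>)\<^sup>2 \<le> l ^ k"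
    using l filterlim_realpow_sequentially_gt1[of l] by (auto simp: filterlim_at_infinity_conv_norm_at_top filterlim_at_top)
  then show ?thesis
  proof eventually_elim
    case (elim k)
    have "1 \<le> LL (l ^ k)" by (rule Log_ge_1)
    then have "l ^ k * 1 \<le> l ^ k * LL (l ^ k)" using l by (intro mult_left_mono) auto
    then have "c / \<kappa> \<le> sqrt (l ^ k * LL (l ^ k))" using elim by (intro real_le_rsqrt) linarith
    then show ?case unfolding lev_def using \<kappa> by (simp add: field_simps)
  qed
qed

text \<open>\<open>k \<mapsto> l\<^sup>k / LL (l\<^sup>k)\<close> increases up to a constant factor.\<close>

lemma lev_ratio:
  assumes "k \<le> j"
  shows "l ^ k * lev l \<kappa> j \<le> 2 * l ^ j * lev l \<kappa> k"
proof (rule power2_le_imp_le)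
  let ?u = "\<lambda>k. LL (l ^ k)"
  have "?u j = LL (l ^ k * l ^ (j - k))" using assms by (simp add: power_add[symmetric])
  also have "\<dots> \<le> 3 * ?u k * ?u (j - k)" using l by (intro LL_mult_le) auto
  also have "\<dots> \<le> 3 * ?u k * l ^ (j - k)"
    using LL_pos[of "l ^ k"] l by (intro mult_left_mono LL_le_self) auto
  finally have "l ^ k * ?u j \<le> l ^ k * (3 * ?u k * l ^ (j - k))"
    using l by (intro mult_left_mono) auto
  also have "\<dots> = 3 * ?u k * l ^ j"
    using assms power_add[of l k "j - k"] by (simp add: mult_ac)
  finally have u: "l ^ k * ?u j \<le> 3 * ?u k * l ^ j" .
  have "(l ^ k * lev l \<kappa> j)\<^sup>2 = (\<kappa>\<^sup>2 * l ^ k * l ^ j) * (l ^ k * ?u j)"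
    by (simp only: power_mult_distrib lev_square) (simp add: power2_eq_square mult_ac)
  \<comment> \<open>The constant 3 of \<open>LL_mult_le\<close> is rounded up to 4, the square of
    the factor 2 in the claim.\<close>
  also have "\<dots> \<le> (\<kappa>\<^sup>2 * l ^ k * l ^ j) * (4 * ?u k * l ^ j)"
  proof (rule mult_left_mono)
    have "0 \<le> ?u k * l ^ j" using l LL_pos[of "l ^ k"] by simp
    then show "l ^ k * ?u j \<le> 4 * ?u k * l ^ j" using u by linarith
  qed (use l in simp)
  also have "\<dots> = (2 * l ^ j * lev l \<kappa> k)\<^sup>2"
    by (simp only: power_mult_distrib lev_square) (simp add: power2_eq_square mult_ac)
  finally show "(l ^ k * lev l \<kappa> j)\<^sup>2 \<le> (2 * l ^ j * lev l \<kappa> k)\<^sup>2" .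
  show "0 \<le> 2 * l ^ j * lev l \<kappa> k" using l lev_pos[of k] by simp
qed

text \<open>The fourth power of a level is \<open>l ^ (2 * k)\<close> times a monotone factor, one
  power of \<open>l ^ k\<close> more than the block length can compensate. The surplus
  \<open>l ^ k / l ^ j\<close> is the geometric decay that the second power would not give.\<close>

lemma lev_ratio_pow4:
  assumes "k \<le> j"
  shows "l ^ j * lev l \<kappa> k ^ 4 \<le> l ^ (2 * k) / l ^ j * lev l \<kappa> j ^ 4"
proof -
  let ?u = "\<lambda>k. LL (l ^ k)"
  have pow4: "lev l \<kappa> i ^ 4 = \<kappa> ^ 4 * (l ^ (2 * i) * (?u i)\<^sup>2)" for i
  proof -
    have "lev l \<kappa> i ^ 4 = ((lev l \<kappa> i)\<^sup>2)\<^sup>2" by simp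
    also have "\<dots> = \<kappa> ^ 4 * (l ^ (2 * i) * (?u i)\<^sup>2)"
      unfolding lev_square power_mult_distrib by (simp add: power_mult[symmetric] mult.commute)
    finally show ?thesis .
  qed
  have "(?u k)\<^sup>2 \<le> (?u j)\<^sup>2"
    using LL_power_mono[OF assms] LL_pos[of "l ^ k"] by (intro power_mono) auto
  then have "\<kappa> ^ 4 * l ^ (2 * k) * l ^ j * (?u k)\<^sup>2 \<le> \<kappa> ^ 4 * l ^ (2 * k) * l ^ j * (?u j)\<^sup>2"
    using l \<kappa> by (intro mult_left_mono) auto
  moreover have "l ^ (2 * k) / l ^ j * lev l \<kappa> j ^ 4 = \<kappa> ^ 4 * l ^ (2 * k) * l ^ j * (?u j)\<^sup>2"
    unfolding pow4 using l by (simp add: mult_2 power_add)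
  ultimately show ?thesis unfolding pow4 by (simp add: mult_ac)
qed

text \<open>Telescoping over the levels: raising the clipping level from index \<open>K\<close> to
  \<open>Suc K\<close> has no effect unless \<open>\<bar>y\<bar>\<close> exceeds the lower level,
  and there the hat equals 1 and pays for the whole change.\<close>

lemma clip_lev_diff_le:
  assumes "k \<le> K"
  shows "\<bar>clip (lev l \<kappa> K) y - clip (lev l \<kappa> k) y\<bar> \<le> (\<Sum>j=k..<K. lev l \<kappa> (Suc j) * hat (lev l \<kappa> j) y)"
  using assms
proof (induction K rule: dec_induct)
  case (step K)
  let ?b = "lev l \<kappa>"
  have "\<bar>clip (?b (Suc K)) y - clip (?b K) y\<bar> \<le> ?b (Suc K) * hat (?b K) y"
  proof (cases "\<bar>y\<bar> \<le> ?b K")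
    case True
    then have "\<bar>y\<bar> \<le> ?b (Suc K)" using lev_mono[of K "Suc K"] by simp
    then show ?thesis using True hat_bounds lev_pos[of "Suc K"] by (simp add: clip_eq_self)
  next
    case False
    then have "hat (?b K) y = 1" using lev_pos by (intro hat_eq_1) auto
    moreover have "\<bar>clip (?b (Suc K)) y - clip (?b K) y\<bar> \<le> ?b (Suc K)"
      using lev_mono[of K "Suc K"] lev_pos[of K] by (auto simp: clip_def)
    ultimately show ?thesis by simp
  qed
  then show ?case using step by simp
qed simp

text \<open>Either the next level changes nothing, or the hat of the current level is 1 and its
  single summand already dominates the clipped fourth power.\<close>

lemma clip_lev_pow4_le:
  "clip (lev l \<kappa> k) y ^ 4 \<le> lev l \<kappa> 0 ^ 4 + (\<Sum>j<k. lev l \<kappa> (Suc j) ^ 4 * hat (lev l \<kappa> j) y)"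
proof (induction k)
  case 0
  have "\<bar>clip (lev l \<kappa> 0) y\<bar> ^ 4 \<le> \<bar>lev l \<kappa> 0\<bar> ^ 4" by (intro power_mono abs_clip_le) simp
  then show ?case by simp
next
  case (Suc k)
  let ?b = "lev l \<kappa>"
  have nn: "0 \<le> (\<Sum>j<k. ?b (Suc j) ^ 4 * hat (?b j) y)" "0 \<le> ?b 0 ^ 4" "0 \<le> ?b (Suc k) ^ 4 * hat (?b k) y"
    using hat_bounds by (auto intro!: sum_nonneg mult_nonneg_nonneg)
  show ?case
  proof (cases "\<bar>y\<bar> \<le> ?b k")
    case True
    then have "\<bar>y\<bar> \<le> ?b (Suc k)" using lev_mono[of k "Suc k"] by simp
    then have "clip (?b (Suc k)) y = clip (?b k) y" using True by (simp add: clip_eq_self)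
    then show ?thesis using Suc nn by simp
  next
    case False
    then have "hat (?b k) y = 1" using lev_pos by (intro hat_eq_1) auto
    have "\<bar>clip (?b (Suc k)) y\<bar> ^ 4 \<le> \<bar>?b (Suc k)\<bar> ^ 4"
      by (intro power_mono abs_clip_le) simp
    then have "clip (?b (Suc k)) y ^ 4 \<le> ?b (Suc k) ^ 4" by simp
    then show ?thesis using nn \<open>hat (?b k) y = 1\<close> by (simp only: sum.lessThan_Suc mult_1_right)
  qed
qed

end

text \<open>The optimisation over \<open>h\<close>, stripped of probability. \<open>N\<close> stands
  for the block length, \<open>m\<close> for the drift, \<open>s2\<close> and \<open>v4\<close> for
  bounds on the second and fourth moments, and \<open>l\<close> for the factor in front of the
  quadratic term; the clipping level is \<open>x / 8\<close>.\<close>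

lemma exponential_block_estimate:
  fixes x y B \<epsilon> N m l s2 v4 \<eta> :: real
  assumes "0 < x" "0 < B" "0 < \<epsilon>" "\<epsilon> < 1" "0 \<le> v4" "0 \<le> m" "0 \<le> l" "0 \<le> s2" "0 < \<eta>"
    and v4: "N * v4 \<le> \<epsilon> * x ^ 4" and m: "N * m \<le> y - x" and B: "N * (l * s2) = B" and n: "real n \<le> N"
  obtains h K where "0 \<le> h" "1 \<le> K"
    "1 + h * m + l * h\<^sup>2 / 2 * s2 + (h / \<eta>) ^ 4 * exp (2 * h * (x / 8)) * v4 \<le> K"
    "K ^ n * exp (- (h * y)) \<le> exp (384 * (2 / \<eta>) ^ 4) * (exp (- (x\<^sup>2 / (2 * B))) + \<epsilon>)"
proof -
  define L where "L = - ln \<epsilon>"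
  have L: "0 < L" "exp (- L) = \<epsilon>" using assms by (auto simp: L_def)
  \<comment> \<open>\<open>x / B\<close> minimises the Gaussian exponent. The cap
    \<open>2 * L / x\<close> keeps \<open>exp (h * x / 4)\<close> below \<open>exp (L / 2)\<close>,
    the inverse square root of \<open>\<epsilon>\<close>. Whichever bound is active,
    \<open>exp (- (h * x / 2))\<close> equals one of the two terms in the claim.\<close>
  define h where "h = min (x / B) (2 * L / x)"
  have h: "0 \<le> h" "h * B \<le> x" "h * x \<le> 2 * L"
    using assms L by (auto simp: h_def min_def field_simps)
  have hx: "h * x / 2 = min (x\<^sup>2 / (2 * B)) L"
    using assms L by (auto simp: h_def min_def field_simps power2_eq_square)
  let ?R = "(h / \<eta>) ^ 4 * exp (2 * h * (x / 8)) * v4"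
  let ?A = "h * m + l * h\<^sup>2 / 2 * s2 + ?R"
  define K where "K = exp ?A"
  have A: "0 \<le> ?A" using assms h by (intro add_nonneg_nonneg mult_nonneg_nonneg) auto
  have "1 + ?A \<le> K" unfolding K_def by (rule exp_ge_add_one_self)
  then have K: "1 \<le> K" "1 + h * m + l * h\<^sup>2 / 2 * s2 + ?R \<le> K" using A by linarith+
  \<comment> \<open>Half of the factor \<open>\<epsilon> = exp (- L)\<close> pays for the
    exponential in the remainder; the other half beats the power \<open>L ^ 4\<close>. Clipping at
    \<open>x / 8\<close> is what makes this division possible.\<close>
  have R: "N * ?R \<le> 384 * (2 / \<eta>) ^ 4"
  proof -
    have "N * ?R = (h / \<eta>) ^ 4 * exp (h * x / 4) * (N * v4)" by (simp add: mult_ac)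
    also have "\<dots> \<le> (h / \<eta>) ^ 4 * exp (h * x / 4) * (\<epsilon> * x ^ 4)"
      by (intro mult_left_mono v4) auto
    also have "\<dots> = ((h * x) ^ 4 * exp (h * x / 4)) * (\<epsilon> / \<eta> ^ 4)"
      by (simp add: power_mult_distrib power_divide mult_ac)
    also have "\<dots> \<le> ((2 * L) ^ 4 * exp (L / 2)) * (\<epsilon> / \<eta> ^ 4)"
    proof (rule mult_right_mono)
      have "(h * x) ^ 4 \<le> (2 * L) ^ 4" by (rule power_mono[OF h(3)]) (use h assms in simp)
      moreover have "exp (h * x / 4) \<le> exp (L / 2)" using h(3) by simp
      ultimately show "(h * x) ^ 4 * exp (h * x / 4) \<le> (2 * L) ^ 4 * exp (L / 2)"
        by (rule mult_mono) auto
    qed (use assms in simp)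
    also have "\<dots> = L ^ 4 * (exp (L / 2) * exp (- L)) * (2 / \<eta>) ^ 4"
      by (simp add: L(2) power_mult_distrib power_divide mult_ac)
    also have "exp (L / 2) * exp (- L) = exp (- (L / 2))" by (simp add: exp_add[symmetric])
    also have "L ^ 4 * exp (- (L / 2)) \<le> 384"
      using power4_le_exp[of L] L(1) by (simp add: exp_minus field_simps)
    finally show ?thesis using assms by (simp add: mult_right_mono)
  qed
  have "K ^ n * exp (- (h * y)) = exp (real n * ?A - h * y)"
    by (simp add: K_def exp_of_nat_mult[symmetric] exp_add[symmetric])
  \<comment> \<open>The drift contributes \<open>h * (y - x)\<close> and the quadratic term at most
    \<open>h * x / 2\<close>, because \<open>h * B \<le> x\<close>; after subtracting
    \<open>h * y\<close> there remains \<open>- (h * x / 2)\<close>.\<close>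
  also have "\<dots> \<le> exp (384 * (2 / \<eta>) ^ 4 - h * x / 2)"
  proof -
    have "real n * ?A \<le> N * ?A" by (intro mult_right_mono n A)
    also have "\<dots> = h * (N * m) + h * (h * (N * (l * s2))) / 2 + N * ?R"
      by (simp add: algebra_simps power2_eq_square)
    also have "\<dots> \<le> h * (y - x) + h * x / 2 + 384 * (2 / \<eta>) ^ 4"
      using B h by (intro add_mono R divide_right_mono mult_left_mono m) auto
    finally show ?thesis by (simp add: algebra_simps)
  qed
  also have "\<dots> = exp (384 * (2 / \<eta>) ^ 4) * exp (- (h * x / 2))"
    by (simp only: exp_add[symmetric] diff_conv_add_uminus)
  also have "exp (- (h * x / 2)) \<le> exp (- (x\<^sup>2 / (2 * B))) + \<epsilon>"
    unfolding hx using L(2) assms(3) by (auto simp: min_def)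
  finally have "K ^ n * exp (- (h * y)) \<le> exp (384 * (2 / \<eta>) ^ 4) * (exp (- (x\<^sup>2 / (2 * B))) + \<epsilon>)"
    by simp
  with h(1) K show ?thesis by (rule that)
qed

lemma geometric_block:
  fixes l :: real
  assumes "1 < l" "l ^ K < x"
  obtains k where "K \<le> k" "l ^ k < x" "x \<le> l ^ Suc k"
proof -
  obtain j where "x < l ^ j" using assms(1) real_arch_pow by blast
  then have ex: "x \<le> l ^ j" by simp
  define j0 where "j0 = (LEAST j. x \<le> l ^ j)"
  have j0: "x \<le> l ^ j0" unfolding j0_def by (rule LeastI[of _ j]) (rule ex)
  then have "l ^ K < l ^ j0" using assms by linarith
  then have "K < j0" using assms(1) by (simp add: power_less_imp_less_exp)
  then obtain k where k: "j0 = Suc k" "K \<le> k" by (cases j0) auto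
  have "\<not> x \<le> l ^ k" by (rule not_less_Least) (use k in \<open>simp add: j0_def\<close>)
  then show ?thesis using that[of k] k j0 by simp
qed

section \<open>Clipped means, fourth moments and the variance\<close>

context iid_space
begin

text \<open>The conversion is faithful: \<open>clipped_mean_tendsto_mean\<close> shows that the
  limit behind \<open>breve_E\<close> exists and is finite.\<close>

definition mean :: real where
  "mean = real_of_ereal (breve_E E (Y 1))"

abbreviation level_weight :: "real \<Rightarrow> real \<Rightarrow> nat \<Rightarrow> real" where
  "level_weight l \<kappa> k \<equiv> e (\<lambda>\<omega>. hat (lev l \<kappa> k) (Y 1 \<omega>))"

lemma clip_Y_bH: "(\<lambda>\<omega>. clip c (Y 1 \<omega>)) \<in> bH"
  by (rule f_Y_bH[OF bdd_Lip_clip]) simp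

context
  fixes l \<kappa> :: real
  assumes l: "1 < l" and \<kappa>: "0 < \<kappa>"
begin

lemma hat_lev_bH: "(\<lambda>\<omega>. hat (lev l \<kappa> k) (Y 1 \<omega>)) \<in> bH"
  by (rule f_Y_bH[OF bdd_Lip_hat[OF lev_pos[OF l \<kappa>]]]) simp

lemma level_weight_nonneg: "0 \<le> level_weight l \<kappa> k"
  by (rule e_nonneg[OF hat_lev_bH hat_bounds(1)])

lemma level_weight_summable: "summable (\<lambda>j. l ^ j * level_weight l \<kappa> j)"
  using tail_summable[OF l \<kappa>] by (simp add: lev_def)

lemma weighted_sum_bH: "(\<lambda>\<omega>. \<Sum>j\<in>I. c j * hat (lev l \<kappa> j) (Y 1 \<omega>)) \<in> bH"
  by (intro bH_sum bH_scale hat_lev_bH)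

lemma e_weighted_sum_le:
  assumes "\<And>j. 0 \<le> c j"
  shows "e (\<lambda>\<omega>. \<Sum>j\<in>I. c j * hat (lev l \<kappa> j) (Y 1 \<omega>)) \<le> (\<Sum>j\<in>I. c j * level_weight l \<kappa> j)"
proof -
  have "e (\<lambda>\<omega>. \<Sum>j\<in>I. c j * hat (lev l \<kappa> j) (Y 1 \<omega>)) \<le> (\<Sum>j\<in>I. e (\<lambda>\<omega>. c j * hat (lev l \<kappa> j) (Y 1 \<omega>)))"
    by (rule e_sum_le[OF bH_scale[OF hat_lev_bH]])
  then show ?thesis by (simp only: e_scale[OF hat_lev_bH assms])
qed

text \<open>The remainder \<open>\<Sum>j\<ge>k. lev (j + 1) * w\<^sub>j\<close> of the clipped means, after multiplying by \<open>l\<^sup>k\<close>,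
  is compared with the tail of the summable series \<open>\<Sum>j. l\<^sup>j * w\<^sub>j\<close>.\<close>

lemma clipped_mean_diff_le:
  assumes "lev l \<kappa> k \<le> c"
  shows "l ^ k * \<bar>e (\<lambda>\<omega>. clip c (Y 1 \<omega>)) - e (\<lambda>\<omega>. clip (lev l \<kappa> k) (Y 1 \<omega>))\<bar>
    \<le> 2 * l * lev l \<kappa> k * (\<Sum>j. l ^ (j + k) * level_weight l \<kappa> (j + k))"
proof -
  let ?b = "lev l \<kappa>" and ?w = "level_weight l \<kappa>"
  obtain K where K: "c \<le> ?b K" "k \<le> K"
    using eventually_conj[OF eventually_lev_ge[OF l \<kappa>, of c] eventually_ge_at_top[of k]]
    by (auto dest: eventually_happens)
  let ?S = "\<lambda>y. \<Sum>j=k..<K. ?b (Suc j) * hat (?b j) y"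
  \<comment> \<open>As \<open>c\<close> lies between the levels with indices \<open>k\<close> and
    \<open>K\<close>, clipping at \<open>c\<close> moves \<open>y\<close> no further from its value
    at level \<open>k\<close> than clipping at level \<open>K\<close> does.\<close>
  have "\<bar>clip c y - clip (?b k) y\<bar> \<le> ?S y" for y
    using clip_lev_diff_le[OF l \<kappa> K(2), of y] assms K(1) lev_pos[OF l \<kappa>, of k]
    by (auto simp: clip_def max_def min_def split: if_splits)
  then have "\<bar>e (\<lambda>\<omega>. clip c (Y 1 \<omega>)) - e (\<lambda>\<omega>. clip (?b k) (Y 1 \<omega>))\<bar> \<le> e (\<lambda>\<omega>. ?S (Y 1 \<omega>))"
    by (intro e_abs_diff_le clip_Y_bH weighted_sum_bH)
  also have "\<dots> \<le> (\<Sum>j=k..<K. ?b (Suc j) * ?w j)"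
    by (intro e_weighted_sum_le less_imp_le lev_pos l \<kappa>)
  finally have "l ^ k * \<bar>e (\<lambda>\<omega>. clip c (Y 1 \<omega>)) - e (\<lambda>\<omega>. clip (?b k) (Y 1 \<omega>))\<bar>
      \<le> l ^ k * (\<Sum>j=k..<K. ?b (Suc j) * ?w j)"
    using l by (intro mult_left_mono) auto
  also have "\<dots> = (\<Sum>j=k..<K. (l ^ k * ?b (Suc j)) * ?w j)"
    by (simp add: sum_distrib_left mult.assoc)
  also have "\<dots> \<le> (\<Sum>j=k..<K. (2 * l ^ Suc j * ?b k) * ?w j)"
  proof (rule sum_mono)
    fix j assume "j \<in> {k..<K}"
    then have "l ^ k * ?b (Suc j) \<le> 2 * l ^ Suc j * ?b k" by (intro lev_ratio[OF l \<kappa>]) simp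
    then show "(l ^ k * ?b (Suc j)) * ?w j \<le> (2 * l ^ Suc j * ?b k) * ?w j"
      by (rule mult_right_mono[OF _ level_weight_nonneg])
  qed
  also have "\<dots> = 2 * l * ?b k * (\<Sum>j=k..<K. l ^ j * ?w j)"
    by (simp add: sum_distrib_left mult_ac)
  also have "(\<Sum>j=k..<K. l ^ j * ?w j) = (\<Sum>j<K - k. l ^ (j + k) * ?w (j + k))"
    using sum.shift_bounds_nat_ivl[of "\<lambda>j. l ^ j * ?w j" 0 k "K - k"] K(2)
    by (simp add: atLeast0LessThan)
  also have "\<dots> \<le> (\<Sum>j. l ^ (j + k) * ?w (j + k))"
    using l level_weight_nonneg level_weight_summable
    by (intro sum_le_suminf) (auto intro: summable_ignore_initial_segment)
  finally show ?thesis using l lev_pos[OF l \<kappa>, of k] by (simp add: mult_left_mono)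
qed

lemma tail_sum_tendsto_0: "(\<lambda>k. \<Sum>j. l ^ (j + k) * level_weight l \<kappa> (j + k)) \<longlonglongrightarrow> 0"
  by (rule suminf_exist_split2[OF level_weight_summable])

lemma clipped_mean_tendsto:
  obtains \<mu> where "((\<lambda>c. e (\<lambda>\<omega>. clip c (Y 1 \<omega>))) \<longlongrightarrow> \<mu>) at_top"
proof -
  let ?b = "lev l \<kappa>" and ?T = "\<lambda>k. \<Sum>j. l ^ (j + k) * level_weight l \<kappa> (j + k)"
  let ?m = "\<lambda>c. e (\<lambda>\<omega>. clip c (Y 1 \<omega>))"
  have bound: "\<bar>?m c - ?m (?b k)\<bar> \<le> 4 * l * ?b 0 * ?T k" if "?b k \<le> c" for c k
  proof -
    have T: "0 \<le> ?T k"
      using l level_weight_nonneg level_weight_summable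
      by (intro suminf_nonneg) (auto intro: summable_ignore_initial_segment)
    have "l ^ k * \<bar>?m c - ?m (?b k)\<bar> \<le> 2 * l * ?b k * ?T k"
      by (rule clipped_mean_diff_le[OF that])
    \<comment> \<open>Comparing with index 0, a level is at most \<open>2 * l ^ k\<close> times the
      initial one, so \<open>l ^ k\<close> cancels and the error is a constant times a tail of a
      convergent series.\<close>
    also have "\<dots> \<le> 2 * l * (2 * l ^ k * ?b 0) * ?T k"
      using lev_ratio[OF l \<kappa>, of 0 k] l T by (intro mult_right_mono mult_left_mono) auto
    also have "\<dots> = l ^ k * (4 * l * ?b 0 * ?T k)" by simp
    finally show ?thesis using l by simp
  qed
  have lim: "(\<lambda>k. 4 * l * ?b 0 * ?T k) \<longlonglongrightarrow> 0"
    by (rule tendsto_mult_right_zero[OF tail_sum_tendsto_0])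
  have "Cauchy (\<lambda>k. ?m (?b k))"
  proof (rule metric_CauchyI)
    fix \<delta> :: real assume "0 < \<delta>"
    then obtain k where k: "4 * l * ?b 0 * ?T k < \<delta> / 2"
      using eventually_happens[OF order_tendstoD(2)[OF lim, of "\<delta> / 2"]] by auto
    have "dist (?m (?b i)) (?m (?b j)) < \<delta>" if "k \<le> i" "k \<le> j" for i j
      using bound[OF lev_mono[OF l \<kappa> that(1)]] bound[OF lev_mono[OF l \<kappa> that(2)]] k
      unfolding dist_real_def by linarith
    then show "\<exists>M. \<forall>m\<ge>M. \<forall>n\<ge>M. dist (?m (?b m)) (?m (?b n)) < \<delta>" by blast
  qed
  then obtain \<mu> where \<mu>: "(\<lambda>k. ?m (?b k)) \<longlonglongrightarrow> \<mu>"
    using Cauchy_convergent convergentD by blast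
  have "(?m \<longlongrightarrow> \<mu>) at_top"
  proof (rule tendstoI)
    fix \<delta> :: real assume "0 < \<delta>"
    then have "\<forall>\<^sub>F k in sequentially. 4 * l * ?b 0 * ?T k < \<delta> / 2"
      by (intro order_tendstoD(2)[OF lim]) simp
    moreover have "\<forall>\<^sub>F k in sequentially. dist (?m (?b k)) \<mu> < \<delta> / 2"
      using \<mu> \<open>0 < \<delta>\<close> by (intro tendstoD) auto
    ultimately have "\<forall>\<^sub>F k in sequentially. 4 * l * ?b 0 * ?T k < \<delta> / 2 \<and> dist (?m (?b k)) \<mu> < \<delta> / 2"
      by (rule eventually_conj)
    then obtain k where k: "4 * l * ?b 0 * ?T k < \<delta> / 2" "dist (?m (?b k)) \<mu> < \<delta> / 2"
      using eventually_happens by force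
    have "dist (?m c) \<mu> < \<delta>" if "?b k \<le> c" for c
      using bound[OF that] k unfolding dist_real_def by linarith
    then show "\<forall>\<^sub>F c in at_top. dist (?m c) \<mu> < \<delta>"
      unfolding eventually_at_top_linorder by blast
  qed
  then show ?thesis by (rule that)
qed

lemma clipped_mean_tendsto_mean: "((\<lambda>c. e (\<lambda>\<omega>. clip c (Y 1 \<omega>))) \<longlongrightarrow> mean) at_top"
proof -
  obtain \<mu> where \<mu>: "((\<lambda>c. e (\<lambda>\<omega>. clip c (Y 1 \<omega>))) \<longlongrightarrow> \<mu>) at_top"
    by (rule clipped_mean_tendsto)
  then have "((\<lambda>c. E (\<lambda>\<omega>. clip c (Y 1 \<omega>))) \<longlongrightarrow> ereal \<mu>) at_top"
    by (simp only: E_eq_e[OF clip_Y_bH] lim_ereal)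
  then have "breve_E E (Y 1) = ereal \<mu>"
    unfolding breve_E_def clip_def[symmetric] by (intro tendsto_Lim) auto
  then show ?thesis using \<mu> by (simp add: mean_def)
qed

text \<open>Let \<open>c\<close> tend to infinity in \<open>clipped_mean_diff_le\<close>. Beyond
  mere convergence, the drift accumulated over a whole block is of smaller order than the level of
  the block.\<close>

lemma clipped_mean_rate: "(\<lambda>k. l ^ k * \<bar>e (\<lambda>\<omega>. clip (lev l \<kappa> k) (Y 1 \<omega>)) - mean\<bar> / lev l \<kappa> k) \<longlonglongrightarrow> 0"
proof (rule tendsto_sandwich[OF _ _ tendsto_const])
  let ?b = "lev l \<kappa>" and ?T = "\<lambda>k. \<Sum>j. l ^ (j + k) * level_weight l \<kappa> (j + k)"
  let ?m = "\<lambda>c. e (\<lambda>\<omega>. clip c (Y 1 \<omega>))"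
  show "(\<lambda>k. 2 * l * ?T k) \<longlonglongrightarrow> 0"
    by (rule tendsto_mult_right_zero[OF tail_sum_tendsto_0])
  show "\<forall>\<^sub>F k in sequentially. 0 \<le> l ^ k * \<bar>?m (?b k) - mean\<bar> / ?b k"
    using l lev_pos[OF l \<kappa>] by (intro always_eventually) (simp add: less_imp_le)
  show "\<forall>\<^sub>F k in sequentially. l ^ k * \<bar>?m (?b k) - mean\<bar> / ?b k \<le> 2 * l * ?T k"
  proof (intro always_eventually allI)
    fix k
    have "((\<lambda>c. l ^ k * \<bar>?m c - ?m (?b k)\<bar>) \<longlongrightarrow> l ^ k * \<bar>mean - ?m (?b k)\<bar>) at_top"
      by (intro tendsto_intros clipped_mean_tendsto_mean)
    moreover have "\<forall>\<^sub>F c in at_top. l ^ k * \<bar>?m c - ?m (?b k)\<bar> \<le> 2 * l * ?b k * ?T k"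
      using eventually_ge_at_top[of "?b k"] by eventually_elim (rule clipped_mean_diff_le)
    ultimately have "l ^ k * \<bar>mean - ?m (?b k)\<bar> \<le> 2 * l * ?b k * ?T k"
      by (rule tendsto_upperbound) simp
    then show "l ^ k * \<bar>?m (?b k) - mean\<bar> / ?b k \<le> 2 * l * ?T k"
      using lev_pos[OF l \<kappa>, of k] by (simp add: field_simps abs_minus_commute)
  qed
qed

text \<open>Splitting the fourth power into levels and using \<open>lev_ratio_pow4\<close> bounds
  the terms by a convolution of the summable \<open>l ^ j * level_weight l \<kappa> j\<close> with a
  geometric sequence, plus a geometric sequence from the constant part.\<close>

lemma trunc_moment4_summable: "summable (\<lambda>k. l ^ k * e (\<lambda>\<omega>. trunc \<mu> (lev l \<kappa> k) \<omega> ^ 4) / lev l \<kappa> k ^ 4)"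
proof (rule summable_comparison_test')
  let ?b = "lev l \<kappa>" and ?w = "level_weight l \<kappa>"
  let ?c = "8 * (?b 0 ^ 4 + \<mu> ^ 4) / ?b 0 ^ 4"
  let ?C = "\<lambda>k. \<Sum>j\<le>k. (l ^ j * ?w j) * (1 / l) ^ (k - j)"
  have "summable ?C"
    by (rule summable_Cauchy_product)
       (use l level_weight_nonneg level_weight_summable in \<open>auto simp: abs_mult\<close>)
  moreover have "summable (\<lambda>k. (1 / l) ^ k)" using l by (intro summable_geometric) simp
  ultimately show "summable (\<lambda>k. ?c * (1 / l) ^ k + 8 * l\<^sup>2 * ?C k)"
    by (intro summable_add summable_mult)
  fix k :: nat
  let ?S = "\<lambda>y. \<Sum>j<k. ?b (Suc j) ^ 4 * hat (?b j) y"
  let ?A = "?b 0 ^ 4 + \<mu> ^ 4"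
  have pt: "(clip (?b k) y - \<mu>) ^ 4 \<le> 8 * ?A + 8 * ?S y" for y
  proof -
    have "(clip (?b k) y - \<mu>) ^ 4 \<le> 8 * clip (?b k) y ^ 4 + 8 * \<mu> ^ 4"
    proof -
      \<comment> \<open>Two applications of the quadratic inequality produce the constant 8.\<close>
      have sq: "(a - d)\<^sup>2 \<le> 2 * a\<^sup>2 + 2 * d\<^sup>2" for a d :: real
        using zero_le_power2[of "a + d"] by (simp add: power2_eq_square algebra_simps)
      have sq': "(a + d)\<^sup>2 \<le> 2 * a\<^sup>2 + 2 * d\<^sup>2" for a d :: real
        using sq[of a "- d"] by simp
      let ?z = "clip (?b k) y"
      have "(?z - \<mu>) ^ 4 = ((?z - \<mu>)\<^sup>2)\<^sup>2" by simp
      also have "\<dots> \<le> (2 * ?z\<^sup>2 + 2 * \<mu>\<^sup>2)\<^sup>2" by (intro power_mono sq) simp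
      also have "\<dots> \<le> 2 * (2 * ?z\<^sup>2)\<^sup>2 + 2 * (2 * \<mu>\<^sup>2)\<^sup>2" by (rule sq')
      finally show ?thesis by (simp add: power_mult_distrib)
    qed
    then show ?thesis using clip_lev_pow4_le[OF l \<kappa>, of k y] by simp
  qed
  have "e (\<lambda>\<omega>. trunc \<mu> (?b k) \<omega> ^ 4) \<le> e (\<lambda>\<omega>. 8 * ?A + 8 * ?S (Y 1 \<omega>))"
    by (intro e_mono trunc_power_bH bH_add bH_const bH_scale weighted_sum_bH pt)
  also have "\<dots> \<le> 8 * ?A + e (\<lambda>\<omega>. 8 * ?S (Y 1 \<omega>))"
  proof -
    have "e (\<lambda>\<omega>. 8 * ?A + 8 * ?S (Y 1 \<omega>)) \<le> e (\<lambda>_. 8 * ?A) + e (\<lambda>\<omega>. 8 * ?S (Y 1 \<omega>))"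
      by (rule e_add_le[OF bH_const bH_scale[OF weighted_sum_bH]])
    then show ?thesis by (simp only: e_const)
  qed
  also have "e (\<lambda>\<omega>. 8 * ?S (Y 1 \<omega>)) = 8 * e (\<lambda>\<omega>. ?S (Y 1 \<omega>))"
    by (rule e_scale[OF weighted_sum_bH]) simp
  also have "e (\<lambda>\<omega>. ?S (Y 1 \<omega>)) \<le> (\<Sum>j<k. ?b (Suc j) ^ 4 * ?w j)"
    by (rule e_weighted_sum_le) simp
  finally have "l ^ k * e (\<lambda>\<omega>. trunc \<mu> (?b k) \<omega> ^ 4) / ?b k ^ 4
      \<le> l ^ k * (8 * ?A + 8 * (\<Sum>j<k. ?b (Suc j) ^ 4 * ?w j)) / ?b k ^ 4"
    using l by (intro divide_right_mono mult_left_mono) auto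
  also have "\<dots> = 8 * ?A * (l ^ k / ?b k ^ 4) + 8 * (\<Sum>j<k. l ^ k * ?b (Suc j) ^ 4 / ?b k ^ 4 * ?w j)"
    by (simp add: sum_distrib_left sum_divide_distrib add_divide_distrib distrib_left mult_ac)
  also have "\<dots> \<le> 8 * ?A * ((1 / l) ^ k / ?b 0 ^ 4) + 8 * (\<Sum>j<k. l ^ (2 * Suc j) / l ^ k * ?w j)"
  proof -
    have b: "0 < ?b i ^ 4" for i by (rule zero_less_power[OF lev_pos[OF l \<kappa>]])
    have ratio: "l ^ k * ?b i ^ 4 / ?b k ^ 4 \<le> l ^ (2 * i) / l ^ k" if "i \<le> k" for i
      using lev_ratio_pow4[OF l \<kappa> that] b[of k] by (simp add: pos_divide_le_eq)
    have "l ^ k / ?b k ^ 4 \<le> (1 / l) ^ k / ?b 0 ^ 4"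
    proof -
      have "l ^ k / ?b k ^ 4 = (l ^ k * ?b 0 ^ 4 / ?b k ^ 4) / ?b 0 ^ 4" using b[of 0] by simp
      also have "\<dots> \<le> (l ^ (2 * 0) / l ^ k) / ?b 0 ^ 4"
        by (rule divide_right_mono[OF ratio]) simp_all
      finally show ?thesis by (simp add: power_one_over)
    qed
    moreover have "(\<Sum>j<k. l ^ k * ?b (Suc j) ^ 4 / ?b k ^ 4 * ?w j) \<le> (\<Sum>j<k. l ^ (2 * Suc j) / l ^ k * ?w j)"
      by (intro sum_mono mult_right_mono ratio level_weight_nonneg) auto
    ultimately show ?thesis using b[of 0] by (intro add_mono mult_left_mono) auto
  qed
  also have "8 * ?A * ((1 / l) ^ k / ?b 0 ^ 4) = ?c * (1 / l) ^ k" by simp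
  also have "(\<Sum>j<k. l ^ (2 * Suc j) / l ^ k * ?w j) = (\<Sum>j<k. l\<^sup>2 * ((l ^ j * ?w j) * (1 / l) ^ (k - j)))"
  \<comment> \<open>The factor \<open>l\<^sup>2\<close> comes from the shift by one: the summand
    with weight at level \<open>j\<close> carries the fourth power of level
    \<open>Suc j\<close>.\<close>
  proof (rule sum.cong)
    fix j assume "j \<in> {..<k}"
    then have "l ^ k = l ^ j * l ^ (k - j)" by (simp add: power_add[symmetric])
    then have "l ^ (2 * Suc j) / l ^ k = l\<^sup>2 * l ^ j * (1 / l) ^ (k - j)"
      using l by (simp add: power_add mult_2 power2_eq_square power_one_over)
    then show "l ^ (2 * Suc j) / l ^ k * ?w j = l\<^sup>2 * ((l ^ j * ?w j) * (1 / l) ^ (k - j))"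
      by (simp add: mult_ac)
  qed simp
  also have "\<dots> = l\<^sup>2 * (\<Sum>j<k. (l ^ j * ?w j) * (1 / l) ^ (k - j))" by (simp add: sum_distrib_left)
  also have "(\<Sum>j<k. (l ^ j * ?w j) * (1 / l) ^ (k - j)) \<le> ?C k"
    using l level_weight_nonneg by (intro sum_mono2) auto
  finally have "l ^ k * e (\<lambda>\<omega>. trunc \<mu> (?b k) \<omega> ^ 4) / ?b k ^ 4 \<le> ?c * (1 / l) ^ k + 8 * l\<^sup>2 * ?C k"
    using l by (simp add: mult_left_mono)
  moreover have "0 \<le> e (\<lambda>\<omega>. trunc \<mu> (?b k) \<omega> ^ 4)" by (rule e_nonneg[OF trunc_power_bH]) simp
  ultimately show "norm (l ^ k * e (\<lambda>\<omega>. trunc \<mu> (?b k) \<omega> ^ 4) / ?b k ^ 4) \<le> ?c * (1 / l) ^ k + 8 * l\<^sup>2 * ?C k"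
    using l by simp
qed

end

text \<open>The limit defining \<open>breve_E\<close> of a square is a supremum of increasing
  truncations, and the squared clipped deviation lies below one of them.\<close>

lemma trunc_variance_le:
  assumes "\<sigma> \<noteq> \<infinity>" "0 \<le> \<sigma>" "\<sigma>\<^sup>2 = breve_E E (\<lambda>\<omega>. (Y 1 \<omega> - \<mu>)\<^sup>2)" and "\<bar>\<mu>\<bar> \<le> b"
  shows "e (\<lambda>\<omega>. (trunc \<mu> b \<omega>)\<^sup>2) \<le> (real_of_ereal \<sigma>)\<^sup>2"
proof -
  \<comment> \<open>The \<open>max 0\<close> makes \<open>g\<close> monotone on the whole line; for
    nonnegative \<open>c\<close> it is the two-sided truncation in \<open>breve_E\<close>, since a
    square never reaches the lower level.\<close>
  define g where "g c = E (\<lambda>\<omega>. min ((Y 1 \<omega> - \<mu>)\<^sup>2) (max 0 c))" for c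
  have bH: "(\<lambda>\<omega>. min ((Y 1 \<omega> - \<mu>)\<^sup>2) (max 0 c)) \<in> bH" for c
    by (rule f_Y_bH[OF bdd_Lip_min_square]) auto
  have g_mono: "g c \<le> g d" if "c \<le> d" for c d
    unfolding g_def using bH that by (intro E_mono bH_imp_H) auto
  have "(g \<longlongrightarrow> (SUP c. g c)) at_top"
  proof (rule order_tendstoI)
    fix a assume "a < (SUP c. g c)"
    then obtain c where "a < g c" by (auto simp: less_SUP_iff)
    then have "a < g d" if "c \<le> d" for d using g_mono[OF that] by simp
    then show "\<forall>\<^sub>F d in at_top. a < g d"
      unfolding eventually_at_top_linorder by blast
  next
    fix a assume "(SUP c. g c) < a"
    then show "\<forall>\<^sub>F d in at_top. g d < a"
      by (intro always_eventually allI) (meson SUP_upper UNIV_I order_le_less_trans)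
  qed
  then have "((\<lambda>c. E (\<lambda>\<omega>. max (- c) (min ((Y 1 \<omega> - \<mu>)\<^sup>2) c))) \<longlongrightarrow> (SUP c. g c)) at_top"
  proof (rule Lim_transform_eventually)
    show "\<forall>\<^sub>F c in at_top. g c = E (\<lambda>\<omega>. max (- c) (min ((Y 1 \<omega> - \<mu>)\<^sup>2) c))"
      using eventually_ge_at_top[of 0]
    proof eventually_elim
      case (elim c)
      have "max (- c) (min (z\<^sup>2) c) = min (z\<^sup>2) (max 0 c)" for z :: real
        using elim order_trans[of "- c" 0 "z\<^sup>2"] by (simp add: max_def min_def)
      then show ?case by (simp add: g_def)
    qed
  qed
  then have sup: "\<sigma>\<^sup>2 = (SUP c. g c)"
    unfolding assms(3) breve_E_def by (intro tendsto_Lim) auto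
  let ?c = "(\<bar>b\<bar> + \<bar>\<mu>\<bar>)\<^sup>2"
  have "(trunc \<mu> b \<omega>)\<^sup>2 \<le> min ((Y 1 \<omega> - \<mu>)\<^sup>2) (max 0 ?c)" for \<omega>
  proof -
    \<comment> \<open>Clipping is a contraction and, because
      \<open>\<bar>\<mu>\<bar> \<le> b\<close>, fixes \<open>\<mu>\<close>.\<close>
    have "\<bar>trunc \<mu> b \<omega>\<bar> \<le> \<bar>Y 1 \<omega> - \<mu>\<bar>"
      using clip_lipschitz[of b "Y 1 \<omega>" \<mu>] assms(4) by (simp add: clip_eq_self)
    moreover have "\<bar>trunc \<mu> b \<omega>\<bar> \<le> \<bar>\<bar>b\<bar> + \<bar>\<mu>\<bar>\<bar>" using abs_clip_le[of b "Y 1 \<omega>"] by linarith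
    ultimately show ?thesis by (simp only: min.bounded_iff abs_le_square_iff le_max_iff_disj simp_thms)
  qed
  then have "e (\<lambda>\<omega>. (trunc \<mu> b \<omega>)\<^sup>2) \<le> e (\<lambda>\<omega>. min ((Y 1 \<omega> - \<mu>)\<^sup>2) (max 0 ?c))"
    by (intro e_mono trunc_power_bH bH)
  then have "ereal (e (\<lambda>\<omega>. (trunc \<mu> b \<omega>)\<^sup>2)) \<le> g ?c"
    unfolding g_def by (simp only: E_eq_e[OF bH] ereal_less_eq)
  also have "\<dots> \<le> \<sigma>\<^sup>2" unfolding sup by (rule SUP_upper) simp
  also have "\<sigma>\<^sup>2 = ereal ((real_of_ereal \<sigma>)\<^sup>2)"
    using assms(1,2) by (cases \<sigma>) auto
  finally show ?thesis by simp
qed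

end

section \<open>Law of the iterated logarithm\<close>

context iid_space
begin

lemma e_trunc_le: "e (trunc \<mu> b) \<le> \<bar>e (\<lambda>\<omega>. clip b (Y 1 \<omega>)) - \<mu>\<bar>"
  using e_add_le[OF clip_Y_bH bH_const, of b "- \<mu>"] by simp

lemma sum_exceeds_measurable:
  "{\<omega> \<in> space M. y < (\<Sum>i=1..n. Y i \<omega> - \<mu>)} \<in> sets M"
proof -
  have "Y i \<in> borel_measurable M" if "i \<in> {1..n}" for i
    using Y_H[of i] H_measurable that by auto
  then have "(\<lambda>\<omega>. \<Sum>i=1..n. Y i \<omega> - \<mu>) \<in> borel_measurable M"
    by (intro borel_measurable_sum borel_measurable_diff) auto
  then show ?thesis by measurable
qed

lemma null_frequently_exceeds:
  fixes \<sigma> r :: real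
  assumes "0 \<le> \<sigma>" "\<sigma> < r"
    and var: "\<And>b. \<bar>mean\<bar> \<le> b \<Longrightarrow> e (\<lambda>\<omega>. (trunc mean b \<omega>)\<^sup>2) \<le> \<sigma>\<^sup>2"
  shows "null {\<omega> \<in> space M. \<exists>\<^sub>\<infinity>n. r * sqrt (2 * real n * LL (real n)) < (\<Sum>i=1..n. Y i \<omega> - mean)}"
proof -
  \<comment> \<open>Two intermediate points between \<open>\<sigma>\<close> and \<open>r\<close>:
    \<open>s\<close> is a positive substitute for \<open>\<sigma>\<close>, which may be 0; the step
    from \<open>r'\<close> to \<open>r\<close> pays for the drift, and the ratio
    \<open>r' / s\<close> for the remaining losses.\<close>
  define s r' where "s = (2 * \<sigma> + r) / 3" and "r' = (\<sigma> + 2 * r) / 3"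
  have s: "0 < s" "\<sigma> < s" "s < r'" "r' < r" using assms(1,2) by (auto simp: s_def r'_def)
  \<comment> \<open>One factor \<open>l\<close> is lost in the block length and one in
    \<open>exp \<eta>\<close>, hence \<open>l * l = q\<close>. The value of \<open>\<kappa>\<close>
    makes eight times the clipping level equal to \<open>r'\<close> times the normaliser at time
    \<open>l ^ k\<close>.\<close>
  define q l \<eta> \<kappa> where "q = r' / s" and "l = sqrt q" and "\<eta> = ln l" and "\<kappa> = r' * sqrt 2 / 8"
  have q: "1 < q" using s by (simp add: q_def)
  have l: "1 < l" "l * l = q" using q by (simp_all add: l_def)
  have \<eta>: "0 < \<eta>" "exp \<eta> = l" using l by (simp_all add: \<eta>_def)
  have \<kappa>: "0 < \<kappa>" using s by (simp add: \<kappa>_def)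
  define b where "b = lev l \<kappa>"
  \<comment> \<open>\<open>y k\<close> is \<open>r\<close> times the normaliser at the left end of
    the block, \<open>N k\<close> the time at its right end. Sums start at 1, so each block event
    includes the whole past and no increments between blocks are needed.\<close>
  define x y N where "x k = 8 * b k" and "y k = r / r' * x k" and "N k = l ^ Suc k" for k
  define n where "n k = nat \<lfloor>N k\<rfloor>" for k
  define m where "m k = \<bar>e (\<lambda>\<omega>. clip (b k) (Y 1 \<omega>)) - mean\<bar>" for k
  define v4 where "v4 k = e (\<lambda>\<omega>. trunc mean (b k) \<omega> ^ 4)" for k
  \<comment> \<open>The added \<open>(1 / 2) ^ k\<close> keeps \<open>\<epsilon> k\<close> positive,
    so that its logarithm makes sense, and does not affect summability.\<close>
  define \<epsilon> B where "\<epsilon> k = N k * v4 k / x k ^ 4 + (1 / 2) ^ k" and "B k = N k * (l * s\<^sup>2)" for k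
  define w where "w k = level_weight l \<kappa> k" for k
  define C where "C = exp (384 * (2 / \<eta>) ^ 4)"
  define v where "v k = 2 * (C * (exp (- (q * LL (l ^ k))) + \<epsilon> k)) + l * (l ^ k * w k)" for k
  define D where "D k = {\<omega> \<in> space M. \<exists>j\<in>{1..n k}. y k < (\<Sum>i=1..j. Y i \<omega> - mean)}" for k
  have b: "0 < b k" for k unfolding b_def by (rule lev_pos[OF l(1) \<kappa>])
  have x: "0 < x k" for k using b by (simp add: x_def)
  have N: "0 < N k" for k using l by (simp add: N_def)
  have v4: "0 \<le> v4 k" for k unfolding v4_def by (rule e_nonneg[OF trunc_power_bH]) simp
  have w: "0 \<le> w k" for k unfolding w_def by (rule level_weight_nonneg[OF l(1) \<kappa>])
  have nN: "real (n k) \<le> N k" for k using N[of k] by (simp add: n_def)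
  have \<epsilon>_pos: "0 < \<epsilon> k" for k
    unfolding \<epsilon>_def using N[of k] v4[of k] x[of k] by (intro add_nonneg_pos) auto
  have \<epsilon>_summable: "summable \<epsilon>"
  proof -
    have "summable (\<lambda>k. l / 8 ^ 4 * (l ^ k * v4 k / b k ^ 4) + (1 / 2) ^ k)"
      unfolding v4_def b_def
      by (intro summable_add summable_mult trunc_moment4_summable[OF l(1) \<kappa>] summable_geometric) simp
    moreover have "\<epsilon> k = l / 8 ^ 4 * (l ^ k * v4 k / b k ^ 4) + (1 / 2) ^ k" for k
      by (simp add: \<epsilon>_def N_def x_def power_mult_distrib)
    ultimately show ?thesis by presburger
  qed
  \<comment> \<open>The squared ratio of \<open>r'\<close> to \<open>s\<close> is the square of
    \<open>q\<close>; one power of \<open>q\<close> is used up by the two factors \<open>l\<close>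
    in \<open>B k\<close>, and \<open>1 < q\<close> remains for the series.\<close>
  have exponent: "(x k)\<^sup>2 / (2 * B k) = q * LL (l ^ k)" for k
  proof -
    have "(x k)\<^sup>2 = 64 * \<kappa>\<^sup>2 * (l ^ k * LL (l ^ k))"
      by (simp add: x_def b_def power_mult_distrib lev_square[OF l(1) \<kappa>])
    also have "64 * \<kappa>\<^sup>2 = 2 * r'\<^sup>2" by (simp add: \<kappa>_def power_mult_distrib power_divide)
    also have "r' = q * s" using s by (simp add: q_def)
    finally have "(x k)\<^sup>2 = q * LL (l ^ k) * (2 * (l ^ k * q * s\<^sup>2))"
      by (simp add: power2_eq_square mult_ac)
    also have "l ^ k * q * s\<^sup>2 = B k" by (simp add: B_def N_def l(2)[symmetric] mult_ac)
    finally show ?thesis using N[of k] l s by (simp add: B_def)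
  qed
  show ?thesis
  proof (rule borel_cantelli)
    show "summable v"
      unfolding v_def w_def
      by (intro summable_add summable_mult summable_exp_LL \<epsilon>_summable l(1) q level_weight_summable \<kappa>)
    show "D k \<in> sets M" for k
    proof -
      have "D k = (\<Union>j\<in>{1..n k}. {\<omega> \<in> space M. y k < (\<Sum>i=1..j. Y i \<omega> - mean)})"
        by (auto simp: D_def)
      then show ?thesis using sum_exceeds_measurable by (simp add: sets.finite_UN)
    qed
    have "\<forall>\<^sub>F k in sequentially. \<epsilon> k < 1"
      using summable_LIMSEQ_zero[OF \<epsilon>_summable] by (rule order_tendstoD) simp
    moreover have "\<forall>\<^sub>F k in sequentially. \<bar>mean\<bar> \<le> b k"
      unfolding b_def by (rule eventually_lev_ge[OF l(1) \<kappa>])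
    \<comment> \<open>Multiplied by \<open>l * b k\<close>, this says that the drift over the block
      is less than the gap \<open>y k - x k\<close>.\<close>
    moreover have "\<forall>\<^sub>F k in sequentially. l ^ k * m k / b k < 8 * (r / r' - 1) / l"
      unfolding m_def b_def using clipped_mean_rate[OF l(1) \<kappa>]
    proof (rule order_tendstoD)
      have "1 < r / r'" using s by simp
      then show "0 < 8 * (r / r' - 1) / l" using l by (intro divide_pos_pos) auto
    qed
    ultimately show "\<forall>\<^sub>F k in sequentially. V_hat M H E (D k) \<le> ereal (v k)"
    proof eventually_elim
      case (elim k)
      have B: "0 < B k" using N[of k] l s by (simp add: B_def)
      have m: "N k * m k \<le> y k - x k"
      proof -
        have "l * (l ^ k * m k) \<le> 8 * (r / r' - 1) * b k"
          using elim(3) b[of k] l by (simp add: field_simps)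
        then show ?thesis by (simp add: N_def y_def x_def algebra_simps)
      qed
      have v4_le: "N k * v4 k \<le> \<epsilon> k * x k ^ 4"
        using x[of k] by (simp add: \<epsilon>_def distrib_right)
      have m0: "0 \<le> m k" by (simp add: m_def)
      have l0: "0 \<le> l" and s0: "0 \<le> s\<^sup>2" using l by auto
      obtain h K where h: "0 \<le> h" and K: "1 \<le> K"
        and mom: "1 + h * m k + l * h\<^sup>2 / 2 * s\<^sup>2 + (h / \<eta>) ^ 4 * exp (2 * h * (x k / 8)) * v4 k \<le> K"
        and bd: "K ^ n k * exp (- (h * y k)) \<le> exp (384 * (2 / \<eta>) ^ 4) * (exp (- ((x k)\<^sup>2 / (2 * B k))) + \<epsilon> k)"
        using exponential_block_estimate[OF x B \<epsilon>_pos elim(1) v4 m0 l0 s0 \<eta>(1) v4_le m B_def[symmetric] nN]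
        by blast
      have var_k: "e (\<lambda>\<omega>. (trunc mean (b k) \<omega>)\<^sup>2) \<le> s\<^sup>2"
        using var[OF elim(2)] power_mono[of \<sigma> s 2] s assms(1) by linarith
      have "e (\<lambda>\<omega>. exp (h * trunc mean (b k) \<omega>)) \<le> 1 + h * e (trunc mean (b k))
          + l * h\<^sup>2 / 2 * e (\<lambda>\<omega>. (trunc mean (b k) \<omega>)\<^sup>2) + (h / \<eta>) ^ 4 * exp (2 * h * b k) * v4 k"
        using exp_moment_bound[OF elim(2) h \<eta>(1)] unfolding \<eta>(2) v4_def .
      also have "\<dots> \<le> 1 + h * m k + l * h\<^sup>2 / 2 * s\<^sup>2 + (h / \<eta>) ^ 4 * exp (2 * h * (x k / 8)) * v4 k"
        using e_trunc_le[where \<mu> = mean and b = "b k"] h l0 var_k unfolding x_def m_def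
        by (intro add_mono mult_left_mono) auto
      also note mom
      finally have "V_hat M H E (D k) \<le> ereal (2 * K ^ n k * exp (- (h * y k)) + real (n k) * w k)"
        unfolding D_def w_def b_def[symmetric] by (intro maximal_inequality b h K)
      also have "2 * K ^ n k * exp (- (h * y k)) + real (n k) * w k \<le> v k"
      proof -
        have "real (n k) * w k \<le> l * (l ^ k * w k)"
          using mult_right_mono[OF nN w, of k k] by (simp add: N_def mult_ac)
        then show ?thesis using bd unfolding v_def C_def exponent by linarith
      qed
      finally show ?case by simp
    qed
    show "{\<omega> \<in> space M. \<exists>\<^sub>\<infinity>n. r * sqrt (2 * real n * LL (real n)) < (\<Sum>i=1..n. Y i \<omega> - mean)}
        \<subseteq> (\<Union>k\<in>{K..}. D k)" for K
    proof safe
      fix \<omega> assume \<omega>: "\<omega> \<in> space M"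
        and inf: "\<exists>\<^sub>\<infinity>n. r * sqrt (2 * real n * LL (real n)) < (\<Sum>i=1..n. Y i \<omega> - mean)"
      \<comment> \<open>Taking the exceeding time beyond \<open>l ^ K\<close> places it in a block
        of index at least \<open>K\<close>; the threshold at that time is at least the one at the
        left end of the block.\<close>
      obtain p where p: "nat \<lceil>l ^ K\<rceil> < p" and gt: "r * sqrt (2 * real p * LL (real p)) < (\<Sum>i=1..p. Y i \<omega> - mean)"
        using inf unfolding INFM_nat by blast
      have "l ^ K < real p" using p by linarith
      then obtain k where k: "K \<le> k" "l ^ k < real p" "real p \<le> l ^ Suc k"
        using geometric_block[OF l(1)] by metis
      have "y k = r * sqrt (2 * (l ^ k * LL (l ^ k)))"
        using s by (simp add: y_def x_def b_def lev_def \<kappa>_def real_sqrt_mult)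
      also have "\<dots> \<le> r * sqrt (2 * (real p * LL (real p)))"
        using k(2) l s LL_mono[of "l ^ k" "real p"] LL_pos[of "l ^ k"]
        by (intro mult_left_mono real_sqrt_le_mono mult_mono) auto
      also have "\<dots> = r * sqrt (2 * real p * LL (real p))" by (simp add: mult.assoc)
      also note gt
      finally have "y k < (\<Sum>i=1..p. Y i \<omega> - mean)" .
      moreover have "p \<in> {1..n k}"
        using p k(3) by (auto simp: n_def N_def le_nat_floor)
      ultimately have "\<omega> \<in> D k" using \<omega> by (auto simp: D_def)
      then show "\<omega> \<in> (\<Union>k\<in>{K..}. D k)" using k(1) by auto
    qed
  qed
qed

lemma null_limsup_gt:
  assumes "0 \<le> \<sigma>" "\<sigma>\<^sup>2 = breve_E E (\<lambda>\<omega>. (Y 1 \<omega> - mean)\<^sup>2)"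
  shows "null {\<omega> \<in> space M. \<sigma> < limsup (\<lambda>n. ereal ((\<Sum>i=1..n. Y i \<omega> - mean)
      / sqrt (2 * real n * LL (real n))))}"
proof (cases "\<sigma> = \<infinity>")
  \<comment> \<open>No extended real exceeds an infinite bound, so the set is empty.\<close>
  case True
  then show ?thesis using null_empty by simp
next
  case False
  then obtain s where s: "\<sigma> = ereal s" "0 \<le> s" using assms(1) by (cases \<sigma>) auto
  let ?S = "\<lambda>n \<omega>. \<Sum>i=1..n. Y i \<omega> - mean"
  let ?a = "\<lambda>n. sqrt (2 * real n * LL (real n))"
  let ?A = "\<lambda>k. {\<omega> \<in> space M. \<exists>\<^sub>\<infinity>n. (s + 1 / real (Suc k)) * ?a n < ?S n \<omega>}"
  have "null (?A k)" for k
  proof (rule null_frequently_exceeds)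
    show "0 \<le> s" by (rule s)
    show "e (\<lambda>\<omega>. (trunc mean b \<omega>)\<^sup>2) \<le> s\<^sup>2" if "\<bar>mean\<bar> \<le> b" for b
      using trunc_variance_le[OF False assms that] s by simp
  qed simp
  then have "null (\<Union>k. ?A k)" by (rule null_UN)
  moreover have "{\<omega> \<in> space M. \<sigma> < limsup (\<lambda>n. ereal (?S n \<omega> / ?a n))} \<subseteq> (\<Union>k. ?A k)"
  proof safe
    fix \<omega> assume \<omega>: "\<omega> \<in> space M" and gt: "\<sigma> < limsup (\<lambda>n. ereal (?S n \<omega> / ?a n))"
    obtain r where r: "s < r" "ereal r < limsup (\<lambda>n. ereal (?S n \<omega> / ?a n))"
      using ereal_dense2[OF gt] s by auto
    obtain k where k: "1 / real (Suc k) < r - s"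
      using reals_Archimedean[of "r - s"] r(1) by (auto simp: inverse_eq_divide)
    have "\<exists>\<^sub>\<infinity>n. (s + 1 / real (Suc k)) * ?a n < ?S n \<omega>"
      unfolding frequently_cofinite[symmetric] cofinite_eq_sequentially
    proof (rule ccontr)
      assume "\<not> (\<exists>\<^sub>F n in sequentially. (s + 1 / real (Suc k)) * ?a n < ?S n \<omega>)"
      then have "\<forall>\<^sub>F n in sequentially. ?S n \<omega> \<le> (s + 1 / real (Suc k)) * ?a n"
        by (simp add: not_frequently not_less)
      then have "\<forall>\<^sub>F n in sequentially. ereal (?S n \<omega> / ?a n) \<le> ereal r"
        \<comment> \<open>At \<open>n = 0\<close> the normaliser is 0 and the inequality cannot be
          divided by it.\<close>
        using eventually_gt_at_top[of 0]
      proof eventually_elim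
        case (elim n)
        have a: "0 < ?a n" using elim(2) LL_pos by simp
        then have "?S n \<omega> / ?a n \<le> s + 1 / real (Suc k)" using elim(1) by (simp add: divide_le_eq)
        then show ?case using k by simp
      qed
      then have "limsup (\<lambda>n. ereal (?S n \<omega> / ?a n)) \<le> ereal r" by (rule Limsup_bounded)
      then show False using r(2) by simp
    qed
    then show "\<omega> \<in> (\<Union>k. ?A k)" using \<omega> by blast
  qed
  ultimately show ?thesis by (rule null_mono)
qed

end

section \<open>From the hypotheses of the theorem to the working assumptions\<close>

lemma choquet_tail_summable:
  fixes Z :: "'a \<Rightarrow> real" and l \<kappa> :: real
  assumes cap: "capacity M V" and meas: "Z \<in> borel_measurable M"
    and fin: "choquet M V (\<lambda>\<omega>. (Z \<omega>)\<^sup>2 / LL \<bar>Z \<omega>\<bar>) < \<infinity>"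
    and l: "1 < l" and \<kappa>: "0 < \<kappa>"
  shows "summable (\<lambda>j. l ^ j * V {\<omega> \<in> space M. \<kappa> * sqrt (l ^ j * LL (l ^ j)) \<le> \<bar>Z \<omega>\<bar>})"
proof -
  let ?G = "\<lambda>t. {\<omega> \<in> space M. t \<le> (Z \<omega>)\<^sup>2 / LL \<bar>Z \<omega>\<bar>}"
  let ?A = "\<lambda>j. {\<omega> \<in> space M. \<kappa> * sqrt (l ^ j * LL (l ^ j)) \<le> \<bar>Z \<omega>\<bar>}"
  have V: "0 \<le> V A" "V A \<le> V A'" "V (space M) = 1" if "A \<in> sets M" "A' \<in> sets M" "A \<subseteq> A'" for A A'
    using cap that unfolding capacity_def by auto
  have LL_meas: "Log \<in> borel_measurable borel"
    by (rule borel_measurable_mono) (simp add: mono_def Log_mono)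
  have G: "?G t \<in> sets M" for t
    using meas LL_meas by measurable
  have A: "?A j \<in> sets M" for j
    using meas by measurable
  \<comment> \<open>The hypothesis bounds a difference of extended reals. The subtracted integral
    vanishes because the integrand is nonnegative, so its level sets at \<open>t \<le> 0\<close> are
    the whole space.\<close>
  have fin': "(\<integral>\<^sup>+t\<in>{0..}. ennreal (V (?G t)) \<partial>lborel) < \<infinity>"
  proof -
    have "V (?G t) = 1" if "t \<le> 0" for t
    proof -
      have "?G t = space M"
        using that by (auto intro!: order_trans[OF that] divide_nonneg_pos LL_pos)
      then show ?thesis using V(3)[of "{}" "{}"] by simp
    qed
    then have "(\<integral>\<^sup>+t\<in>{..0}. ennreal (1 - V (?G t)) \<partial>lborel) = (\<integral>\<^sup>+t. 0 \<partial>(lborel :: real measure))"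
      by (intro nn_integral_cong) (auto simp: indicator_def)
    then have "enn2ereal (\<integral>\<^sup>+t\<in>{0..}. ennreal (V (?G t)) \<partial>lborel) < \<infinity>"
      using fin unfolding choquet_def by (simp add: zero_ennreal.rep_eq)
    then show ?thesis by (auto simp: less_top[symmetric])
  qed
  \<comment> \<open>Two bounds on \<open>c\<close> for two cases below: if
    \<open>\<bar>Z \<omega>\<bar> \<le> l ^ j\<close>, monotonicity of \<open>LL\<close> and
    \<open>c \<le> \<kappa>\<^sup>2\<close> suffice; otherwise \<open>LL z \<le> z\<close> and
    \<open>c \<le> 1\<close> do.\<close>
  define c where "c = min 1 (\<kappa>\<^sup>2)"
  have c: "0 < c" "c \<le> 1" "c \<le> \<kappa>\<^sup>2" using \<kappa> by (auto simp: c_def)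
  have AG: "?A j \<subseteq> ?G (c * l ^ j)" for j
  proof safe
    fix \<omega> assume "\<kappa> * sqrt (l ^ j * LL (l ^ j)) \<le> \<bar>Z \<omega>\<bar>"
    define z where "z = \<bar>Z \<omega>\<bar>"
    have z: "\<kappa> * sqrt (l ^ j * LL (l ^ j)) \<le> z" "0 \<le> z" by (simp_all add: z_def) fact
    have lj: "1 \<le> l ^ j" using l by simp
    have "c * l ^ j * LL z \<le> z\<^sup>2"
    proof (cases "z \<le> l ^ j")
      case True
      have "c * l ^ j * LL z \<le> \<kappa>\<^sup>2 * l ^ j * LL (l ^ j)"
        using c lj LL_mono[OF True] LL_pos[of z] by (intro mult_mono) auto
      also have "\<dots> = (\<kappa> * sqrt (l ^ j * LL (l ^ j)))\<^sup>2"
        using lj LL_pos[of "l ^ j"] by (simp add: power_mult_distrib)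
      also have "\<dots> \<le> z\<^sup>2"
        using z \<kappa> lj LL_pos[of "l ^ j"] by (intro power_mono) auto
      finally show ?thesis .
    next
      case False
      then have "c * l ^ j * LL z \<le> z * z"
        using c lj LL_le_self[of z] LL_pos[of z] mult_mono[of c 1 "l ^ j" z] by (intro mult_mono) auto
      then show ?thesis by (simp add: power2_eq_square)
    qed
    then show "c * l ^ j \<le> (Z \<omega>)\<^sup>2 / LL \<bar>Z \<omega>\<bar>"
      using LL_pos[of z] by (simp add: z_def pos_le_divide_eq)
  qed
  \<comment> \<open>On this interval, of length \<open>c * (1 - 1 / l) * l ^ j\<close>, the Choquet
    integrand is at least the \<open>j\<close>-th capacity. The intervals are disjoint, so the
    series is bounded by a constant times the integral.\<close>
  let ?I = "\<lambda>j. {c * l ^ j / l <.. c * l ^ j}"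
  have disj: "disjoint_family ?I"
  proof -
    have "?I i \<inter> ?I j = {}" if "i < j" for i j
    proof -
      have "l ^ Suc i \<le> l ^ j" using l that by (intro power_increasing) auto
      then have "c * l ^ i \<le> c * l ^ j / l" using l c by (simp add: field_simps)
      then show ?thesis by auto
    qed
    then show ?thesis
      unfolding disjoint_family_on_def by (metis inf_commute linorder_neqE_nat)
  qed
  let ?f = "\<lambda>j. c * (1 - 1 / l) * (l ^ j * V (?A j))"
  have f0: "0 \<le> ?f j" for j
    using c l V(1)[OF A A, of j j] by (intro mult_nonneg_nonneg) auto
  have "(\<Sum>j. ennreal (?f j)) = (\<Sum>j. \<integral>\<^sup>+t. ennreal (V (?A j)) * indicator (?I j) t \<partial>lborel)"
  proof (rule arg_cong[where f = suminf], rule ext)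
    fix j
    have "c * l ^ j / l \<le> c * l ^ j" using l c by (simp add: field_simps)
    then have "(\<integral>\<^sup>+t. ennreal (V (?A j)) * indicator (?I j) t \<partial>lborel) = ennreal (V (?A j)) * ennreal (c * l ^ j - c * l ^ j / l)"
      by (simp add: nn_integral_cmult_indicator)
    also have "\<dots> = ennreal (V (?A j) * (c * l ^ j - c * l ^ j / l))"
      using V(1)[OF A A, of j j] by (simp add: ennreal_mult')
    finally show "ennreal (?f j) = (\<integral>\<^sup>+t. ennreal (V (?A j)) * indicator (?I j) t \<partial>lborel)"
      by (simp add: algebra_simps)
  qed
  also have "\<dots> = (\<integral>\<^sup>+t. (\<Sum>j. ennreal (V (?A j)) * indicator (?I j) t) \<partial>lborel)"
    by (rule nn_integral_suminf[symmetric]) simp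
  also have "\<dots> \<le> (\<integral>\<^sup>+t\<in>{0..}. ennreal (V (?G t)) \<partial>lborel)"
  proof (rule nn_integral_mono)
    fix t :: real
    show "(\<Sum>j. ennreal (V (?A j)) * indicator (?I j) t) \<le> ennreal (V (?G t)) * indicator {0..} t"
    proof (cases "\<exists>j. t \<in> ?I j")
      case True
      then obtain i where i: "t \<in> ?I i" by blast
      have "t \<notin> ?I j" if "j \<noteq> i" for j
        using disj i that unfolding disjoint_family_on_def by blast
      then have "indicator (?I j) t = (if j = i then 1 else 0 :: ennreal)" for j
        using i by (simp add: indicator_def del: greaterThanAtMost_iff)
      then have "(\<lambda>j. ennreal (V (?A j)) * indicator (?I j) t) = (\<lambda>j. if j = i then ennreal (V (?A j)) else 0)"
        by (simp only: mult_1_right mult_zero_right if_distrib[of "(*) _"])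
      then have "(\<Sum>j. ennreal (V (?A j)) * indicator (?I j) t) = ennreal (V (?A i))"
        using sums_unique[OF sums_single[of i "\<lambda>j. ennreal (V (?A j))"]] by simp
      also have "V (?A i) \<le> V (?G t)"
        using AG[of i] i by (intro V(2) A G) auto
      then have "ennreal (V (?A i)) \<le> ennreal (V (?G t)) * indicator {0..} t"
      proof -
        have "0 \<le> c * l ^ i / l" using c l by simp
        then have "0 \<le> t" using i by simp
        then show ?thesis using \<open>V (?A i) \<le> V (?G t)\<close> by (simp add: ennreal_leI)
      qed
      finally show ?thesis .
    next
      case False
      then have "(\<lambda>j. ennreal (V (?A j)) * indicator (?I j) t) = (\<lambda>_. 0)"
        by (auto simp: fun_eq_iff)
      then show ?thesis by simp
    qed
  qed
  finally have "(\<Sum>j. ennreal (?f j)) < \<infinity>" using fin' by (rule order_le_less_trans)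
  then have "summable ?f"
    using f0 by (intro summable_suminf_not_top) (auto simp: less_top)
  moreover have "c * (1 - 1 / l) \<noteq> 0" using c l by simp
  ultimately show ?thesis by (subst (asm) summable_cmult_iff) auto
qed

text \<open>For two pasts the integrands differ by at most a constant, and the expectation inherits
  this bound. So a partial expectation evaluated at earlier variables is again a bounded element of
  \<open>H\<close>.\<close>

lemma (in sublinear_expectation_space) bdd_Lip_e_fun_upd:
  assumes "bdd_Lip (ldist (Suc k)) \<phi>" "X \<in> H"
  shows "bdd_Lip (ldist k) (\<lambda>x. e (\<lambda>\<omega>. \<phi> (x(k := X \<omega>))))"
proof -
  obtain B L where \<phi>: "\<And>x. \<bar>\<phi> x\<bar> \<le> B" "\<And>x y. \<bar>\<phi> x - \<phi> y\<bar> \<le> L * ldist (Suc k) x y"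
    using assms(1) by (rule bdd_LipE) blast
  have bH: "(\<lambda>\<omega>. \<phi> (x(k := X \<omega>))) \<in> bH" for x
    by (rule bdd_Lip_bH[OF bdd_Lip_fun_upd[OF assms(1)] assms(2)])
  show ?thesis
  proof (rule bdd_LipI)
    show "\<bar>e (\<lambda>\<omega>. \<phi> (x(k := X \<omega>)))\<bar> \<le> B" for x
      using E_bounds[OF bH \<phi>(1), of x] E_eq_e[OF bH, of x] by (simp add: abs_le_iff)
    show "\<bar>e (\<lambda>\<omega>. \<phi> (x(k := X \<omega>))) - e (\<lambda>\<omega>. \<phi> (y(k := X \<omega>)))\<bar> \<le> L * ldist k x y" for x y
    proof -
      have "\<bar>\<phi> (x(k := X \<omega>)) - \<phi> (y(k := X \<omega>))\<bar> \<le> L * ldist k x y" for \<omega>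
        using \<phi>(2)[of "x(k := X \<omega>)" "y(k := X \<omega>)"] by simp
      then have "\<bar>e (\<lambda>\<omega>. \<phi> (x(k := X \<omega>))) - e (\<lambda>\<omega>. \<phi> (y(k := X \<omega>)))\<bar> \<le> e (\<lambda>_. L * ldist k x y)"
        by (intro e_abs_diff_le bH bH_const)
      then show ?thesis by simp
    qed
  qed
qed

text \<open>For bounded Lipschitz \<open>\<phi>\<close> all side conditions of
  \<open>independent_to\<close> hold by \<open>bdd_Lip_e_fun_upd\<close>; monotonicity then passes
  from the exact partial expectation to its majorant \<open>\<psi>\<close>.\<close>

lemma (in sublinear_expectation_space) independent_seq_step:
  assumes Y: "\<And>i. 1 \<le> i \<Longrightarrow> Y i \<in> H" and ind: "independent_seq H E Y" and k: "1 \<le> k"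
    and \<phi>: "bdd_Lip (ldist (Suc k)) \<phi>" and \<psi>: "bdd_Lip (ldist k) \<psi>"
    and le: "\<And>x. E (\<lambda>\<omega>. \<phi> (x(k := Y (Suc k) \<omega>))) \<le> ereal (\<psi> x)"
  shows "E (\<lambda>\<omega>. \<phi> (\<lambda>j. Y (Suc j) \<omega>)) \<le> E (\<lambda>\<omega>. \<psi> (\<lambda>j. Y (Suc j) \<omega>))"
proof -
  let ?sub = "\<lambda>\<theta> x. E (\<lambda>\<omega>. \<theta> (vec_append k x (\<lambda>i. Y (k + 1) \<omega>)))"
  let ?sub' = "\<lambda>\<theta> x. e (\<lambda>\<omega>. \<theta> (x(k := Y (Suc k) \<omega>)))"
  have Yk: "Y (Suc k) \<in> H" by (rule Y) simp
  have sub: "?sub \<theta> x = ereal (?sub' \<theta> x)" if "bdd_Lip (ldist (Suc k)) \<theta>" for \<theta> x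
  proof -
    \<comment> \<open>The two arguments agree only on the first \<open>k + 1\<close> coordinates,
      and \<open>\<theta>\<close> sees no others.\<close>
    have "\<theta> (vec_append k x (\<lambda>i. Y (k + 1) \<omega>)) = \<theta> (x(k := Y (Suc k) \<omega>))" for \<omega>
      by (rule bdd_Lip_cong_coordinates[OF that]) (auto simp: vec_append_def less_Suc_eq)
    then show ?thesis
      using E_eq_e[OF bdd_Lip_bH[OF bdd_Lip_fun_upd[OF that] Yk]] by simp
  qed
  have vec: "(\<lambda>\<omega>. \<theta> (\<lambda>j. Y (j + 1) \<omega>)) \<in> bH" if "bdd_Lip (ldist k) \<theta>" for \<theta>
    by (rule bdd_Lip_vec_bH[OF that]) (simp add: Y)
  have \<phi>': "bdd_Lip (ldist (Suc k)) (\<lambda>x. \<bar>\<phi> x\<bar>)" by (rule bdd_Lip_abs[OF \<phi>])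
  have sub_\<phi>: "(\<lambda>\<omega>. ?sub' \<phi> (\<lambda>j. Y (j + 1) \<omega>)) \<in> bH"
    by (rule vec[OF bdd_Lip_e_fun_upd[OF \<phi> Yk]])
  have sub_abs: "(\<lambda>\<omega>. \<bar>?sub' (\<lambda>x. \<bar>\<phi> x\<bar>) (\<lambda>j. Y (j + 1) \<omega>)\<bar>) \<in> bH"
    by (rule vec[OF bdd_Lip_abs[OF bdd_Lip_e_fun_upd[OF \<phi>' Yk]]])
  have "\<phi> \<in> C_l_Lip (k + 1)" using bdd_Lip_imp_C_l_Lip[OF \<phi>] by simp
  moreover have "independent_to H E 1 (\<lambda>_. Y (k + 1)) k (\<lambda>j. Y (j + 1))"
    using ind k unfolding independent_seq_def by blast
  ultimately have "E (\<lambda>\<omega>. \<phi> (vec_append k (\<lambda>j. Y (j + 1) \<omega>) (\<lambda>i. Y (k + 1) \<omega>)))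
      = E (\<lambda>\<omega>. real_of_ereal (?sub \<phi> (\<lambda>j. Y (j + 1) \<omega>)))"
    unfolding independent_to_def Let_def
    using sub[OF \<phi>] sub[OF \<phi>'] bH_imp_H[OF sub_\<phi>] bH_imp_H[OF sub_abs] E_eq_e[OF sub_abs] by simp
  moreover have "\<phi> (vec_append k (\<lambda>j. Y (j + 1) \<omega>) (\<lambda>i. Y (k + 1) \<omega>)) = \<phi> (\<lambda>j. Y (Suc j) \<omega>)" for \<omega>
    by (rule bdd_Lip_cong_coordinates[OF \<phi>]) (auto simp: vec_append_def less_Suc_eq)
  ultimately have "E (\<lambda>\<omega>. \<phi> (\<lambda>j. Y (Suc j) \<omega>)) = E (\<lambda>\<omega>. ?sub' \<phi> (\<lambda>j. Y (j + 1) \<omega>))"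
    by (simp only: sub[OF \<phi>] real_of_ereal.simps)
  also have "\<dots> \<le> E (\<lambda>\<omega>. \<psi> (\<lambda>j. Y (j + 1) \<omega>))"
  proof (rule E_mono[OF bH_imp_H[OF vec[OF \<psi>]] bH_imp_H[OF sub_\<phi>]])
    fix \<omega>
    show "?sub' \<phi> (\<lambda>j. Y (j + 1) \<omega>) \<le> \<psi> (\<lambda>j. Y (j + 1) \<omega>)"
      using le[of "\<lambda>j. Y (j + 1) \<omega>"] E_eq_e[OF bdd_Lip_bH[OF bdd_Lip_fun_upd[OF \<phi>] Yk]] by simp
  qed
  finally show ?thesis by simp
qed

lemma iid_spaceI:
  assumes "sublinear_expectation_space M H E"
    and Y: "\<And>i. 1 \<le> i \<Longrightarrow> Y i \<in> H"
    and ind: "independent_seq H E Y" and id: "identically_distributed_seq E Y"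
    and cap: "capacity M V" and C: "property_C M H E V"
    and fin: "choquet M V (\<lambda>\<omega>. (Y 1 \<omega>)\<^sup>2 / LL \<bar>Y 1 \<omega>\<bar>) < \<infinity>"
  shows "iid_space M H E Y"
proof -
  interpret sublinear_expectation_space M H E by fact
  show ?thesis
  proof unfold_locales
    show "Y i \<in> H" if "1 \<le> i" for i by (rule Y[OF that])
    show "E (\<lambda>\<omega>. f (Y i \<omega>)) = E (\<lambda>\<omega>. f (Y 1 \<omega>))" if f: "bdd_Lip rdist f" and i: "1 \<le> i" for f i
    proof -
      obtain B L where BL: "\<And>x. \<bar>f x\<bar> \<le> B" "\<And>x y. \<bar>f x - f y\<bar> \<le> L * \<bar>x - y\<bar>"
        using f by (rule bdd_LipE) blast
      have "bounded (range f)" using BL(1) by (auto simp: bounded_iff)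
      moreover have "(max 0 L)-lipschitz_on UNIV f"
      proof (rule lipschitz_onI)
        show "dist (f x) (f y) \<le> max 0 L * dist x y" for x y
          using BL(2)[of x y] mult_right_mono[of L "max 0 L" "\<bar>x - y\<bar>"] by (simp add: dist_real_def)
      qed simp
      ultimately show ?thesis using id i unfolding identically_distributed_seq_def by blast
    qed
    show "E (\<lambda>\<omega>. \<phi> (\<lambda>j. Y (Suc j) \<omega>)) \<le> E (\<lambda>\<omega>. \<psi> (\<lambda>j. Y (Suc j) \<omega>))"
      if "1 \<le> k" "bdd_Lip (ldist (Suc k)) \<phi>" "bdd_Lip (ldist k) \<psi>"
        "\<And>x. E (\<lambda>\<omega>. \<phi> (x(k := Y (Suc k) \<omega>))) \<le> ereal (\<psi> x)" for k \<phi> \<psi>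
      by (rule independent_seq_step[OF Y ind that])
    show "summable (\<lambda>j. l ^ j * e (\<lambda>\<omega>. hat (\<kappa> * sqrt (l ^ j * LL (l ^ j))) (Y 1 \<omega>)))"
      if l: "1 < l" and \<kappa>: "0 < \<kappa>" for l \<kappa>
    proof (rule summable_comparison_test')
      have meas: "Y 1 \<in> borel_measurable M" using Y[of 1] H_measurable by auto
      \<comment> \<open>The level is halved because \<open>hat\<close> vanishes only up to half of
        its own level; with this event, property (C) applies between \<open>hat\<close> and the
        constant 1.\<close>
      show "summable (\<lambda>j. l ^ j * V {\<omega> \<in> space M. \<kappa> / 2 * sqrt (l ^ j * LL (l ^ j)) \<le> \<bar>Y 1 \<omega>\<bar>})"
        by (rule choquet_tail_summable[OF cap meas fin l]) (use \<kappa> in simp)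
      fix j :: nat
      let ?b = "\<kappa> * sqrt (l ^ j * LL (l ^ j))"
      let ?A = "{\<omega> \<in> space M. \<kappa> / 2 * sqrt (l ^ j * LL (l ^ j)) \<le> \<bar>Y 1 \<omega>\<bar>}"
      have b: "0 < ?b" using lev_pos[OF l \<kappa>, of j] by (simp add: lev_def)
      have A: "?A \<in> sets M" using meas by measurable
      have bH: "(\<lambda>\<omega>. hat ?b (Y 1 \<omega>)) \<in> bH" by (rule bdd_Lip_bH[OF bdd_Lip_hat[OF b] Y]) simp
      have "hat ?b (Y 1 \<omega>) \<le> indicator ?A \<omega>" if "\<omega> \<in> space M" for \<omega>
      proof (cases "\<omega> \<in> ?A")
        case True
        then show ?thesis using hat_bounds by (simp del: mem_Collect_eq)
      next
        case False
        then have "hat ?b (Y 1 \<omega>) = 0" using that by (intro hat_eq_0[OF b]) simp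
        then show ?thesis by simp
      qed
      moreover have "indicator ?A \<omega> \<le> (1 :: real)" for \<omega> by (simp add: indicator_def)
      ultimately have "E (\<lambda>\<omega>. hat ?b (Y 1 \<omega>)) \<le> ereal (V ?A)"
        using C[unfolded property_C_def, rule_format, OF bH_imp_H[OF bH] bH_imp_H[OF bH_const[of 1]] A]
        by blast
      then have "e (\<lambda>\<omega>. hat ?b (Y 1 \<omega>)) \<le> V ?A" by (simp only: E_eq_e[OF bH] ereal_less_eq)
      moreover have "0 \<le> e (\<lambda>\<omega>. hat ?b (Y 1 \<omega>))" by (rule e_nonneg[OF bH hat_bounds(1)])
      ultimately show "norm (l ^ j * e (\<lambda>\<omega>. hat ?b (Y 1 \<omega>))) \<le> l ^ j * V ?A"
        using l by (simp add: abs_mult mult_left_mono)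
    qed
  qed
qed

lemma bdd_Lip_ldist_uminus:
  assumes "bdd_Lip (ldist n) \<phi>"
  shows "bdd_Lip (ldist n) (\<lambda>x. \<phi> (\<lambda>i. - x i))"
proof -
  obtain B L where \<phi>: "\<And>x. \<bar>\<phi> x\<bar> \<le> B" "\<And>x y. \<bar>\<phi> x - \<phi> y\<bar> \<le> L * ldist n x y"
    using assms by (rule bdd_LipE) blast
  show ?thesis
  proof (rule bdd_LipI)
    show "\<bar>\<phi> (\<lambda>i. - x i)\<bar> \<le> B" for x by (rule \<phi>)
    show "\<bar>\<phi> (\<lambda>i. - x i) - \<phi> (\<lambda>i. - y i)\<bar> \<le> L * ldist n x y" for x y
      using \<phi>(2)[of "\<lambda>i. - x i" "\<lambda>i. - y i"] by (simp add: abs_minus_commute)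
  qed
qed

text \<open>Each property for the reflected sequence is the original one for a reflected test
  function; the tail condition is unchanged because \<open>hat\<close> is even.\<close>

lemma (in iid_space) iid_space_uminus: "iid_space M H E (\<lambda>i \<omega>. - Y i \<omega>)"
proof unfold_locales
  show "(\<lambda>\<omega>. - Y i \<omega>) \<in> H" if "1 \<le> i" for i
    using H_scale[OF Y_H[OF that], of "-1"] by simp
  show "E (\<lambda>\<omega>. f (- Y i \<omega>)) = E (\<lambda>\<omega>. f (- Y 1 \<omega>))" if f: "bdd_Lip rdist f" and "1 \<le> i" for f i
  proof -
    obtain B L where BL: "\<And>x. \<bar>f x\<bar> \<le> B" "\<And>x y. \<bar>f x - f y\<bar> \<le> L * \<bar>x - y\<bar>"
      using f by (rule bdd_LipE) blast
    have "bdd_Lip rdist (\<lambda>y. f (- y))"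
    proof (rule bdd_LipI)
      show "\<bar>f (- x)\<bar> \<le> B" for x by (rule BL)
      show "\<bar>f (- x) - f (- y)\<bar> \<le> L * \<bar>x - y\<bar>" for x y
        using BL(2)[of "- x" "- y"] by (simp add: abs_minus_commute)
    qed
    then show ?thesis by (rule ident[OF _ \<open>1 \<le> i\<close>])
  qed
  show "E (\<lambda>\<omega>. \<phi> (\<lambda>j. - Y (Suc j) \<omega>)) \<le> E (\<lambda>\<omega>. \<psi> (\<lambda>j. - Y (Suc j) \<omega>))"
    if k: "1 \<le> k" and \<phi>: "bdd_Lip (ldist (Suc k)) \<phi>" and \<psi>: "bdd_Lip (ldist k) \<psi>"
      and le: "\<And>x. E (\<lambda>\<omega>. \<phi> (x(k := - Y (Suc k) \<omega>))) \<le> ereal (\<psi> x)" for k \<phi> \<psi>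
  proof (rule indep[OF k bdd_Lip_ldist_uminus[OF \<phi>] bdd_Lip_ldist_uminus[OF \<psi>]])
    fix x :: "nat \<Rightarrow> real"
    have "(\<lambda>i. - (x(k := y)) i) = (\<lambda>i. - x i)(k := - y)" for y by auto
    then show "E (\<lambda>\<omega>. \<phi> (\<lambda>i. - (x(k := Y (Suc k) \<omega>)) i)) \<le> ereal (\<psi> (\<lambda>i. - x i))"
      using le[of "\<lambda>i. - x i"] by simp
  qed
  show "summable (\<lambda>j. l ^ j * e (\<lambda>\<omega>. hat (\<kappa> * sqrt (l ^ j * LL (l ^ j))) (- Y 1 \<omega>)))"
    if "1 < l" "0 < \<kappa>" for l \<kappa>
    using tail_summable[OF that] by (simp only: hat_minus)
qed

text \<open>The theorem centres every variable at its own mean, whereas the proof uses a single one;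
  clipping is a test function to which identical distribution applies.\<close>

lemma (in iid_space) breve_E_Y:
  assumes "1 \<le> i"
  shows "real_of_ereal (breve_E E (Y i)) = mean"
  unfolding mean_def breve_E_def clip_def[symmetric]
  by (simp only: ident[OF bdd_Lip_clip assms])

theorem theorem5p3:
  fixes M :: "'a measure" and H :: "('a \<Rightarrow> real) set" and E :: "('a \<Rightarrow> real) \<Rightarrow> ereal"
    and Y :: "nat \<Rightarrow> 'a \<Rightarrow> real" and V :: "'a set \<Rightarrow> real" and \<sigma>1 \<sigma>2 :: ereal
  assumes "sublinear_expectation_space M H E"
    and "\<And>i. i \<ge> 1 \<Longrightarrow> Y i \<in> H"
    and "independent_seq H E Y"
    and "identically_distributed_seq E Y"
    and "subadditive_capacity M V"
    and "property_C M H E V"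
    and "choquet M V (\<lambda>\<omega>. (Y 1 \<omega>)\<^sup>2 / Log (Log \<bar>Y 1 \<omega>\<bar>)) < \<infinity>"
    and "0 \<le> \<sigma>2"
    and "\<sigma>2\<^sup>2 = breve_E E (\<lambda>\<omega>. (Y 1 \<omega> - real_of_ereal (breve_E E (Y 1)))\<^sup>2)"
    and "0 \<le> \<sigma>1"
    and "\<sigma>1\<^sup>2 = breve_E E (\<lambda>\<omega>. (Y 1 \<omega> + real_of_ereal (breve_E E (\<lambda>\<omega>'. - Y 1 \<omega>')))\<^sup>2)"
  shows "V_hat_star M H E
     {\<omega> \<in> space M.
        liminf (\<lambda>n. ereal ((\<Sum>i=1..n. (Y i \<omega> + real_of_ereal (breve_E E (\<lambda>\<omega>'. - Y i \<omega>'))))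
                             / sqrt (2 * real n * Log (Log (real n))))) < - \<sigma>1 \<or>
        limsup (\<lambda>n. ereal ((\<Sum>i=1..n. (Y i \<omega> - real_of_ereal (breve_E E (Y i))))
                             / sqrt (2 * real n * Log (Log (real n))))) > \<sigma>2} = 0"
proof -
  have cap: "capacity M V" using assms(5) by (simp add: subadditive_capacity_def)
  interpret iid_space M H E Y
    by (rule iid_spaceI[OF assms(1-4) cap assms(6,7)])
  interpret neg: iid_space M H E "\<lambda>i \<omega>. - Y i \<omega>" by (rule iid_space_uminus)
  let ?a = "\<lambda>n. sqrt (2 * real n * LL (real n))"
  let ?A = "{\<omega> \<in> space M. \<sigma>2 < limsup (\<lambda>n. ereal ((\<Sum>i=1..n. Y i \<omega> - mean) / ?a n))}"
  let ?B = "{\<omega> \<in> space M. \<sigma>1 < limsup (\<lambda>n. ereal ((\<Sum>i=1..n. - Y i \<omega> - neg.mean) / ?a n))}"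
  have "null ?A"
    by (rule null_limsup_gt[OF assms(8)]) (simp only: assms(9) mean_def)
  moreover have "null ?B"
  proof (rule neg.null_limsup_gt[OF assms(10)])
    have "(y + m)\<^sup>2 = (- y - m)\<^sup>2" for y m :: real by (simp add: power2_eq_square algebra_simps)
    then show "\<sigma>1\<^sup>2 = breve_E E (\<lambda>\<omega>. (- Y 1 \<omega> - neg.mean)\<^sup>2)"
      unfolding assms(11) neg.mean_def by presburger
  qed
  ultimately have null: "null (?A \<union> ?B)" by (rule null_Un)
  \<comment> \<open>Reflection turns the event that the lower limit is below
    \<open>- \<sigma>1\<close> into the event that the upper limit of the reflected sums exceeds
    \<open>\<sigma>1\<close>, since \<open>neg.mean\<close> is the mean of the reflected
    variables.\<close>
  have "liminf (\<lambda>n. ereal ((\<Sum>i=1..n. Y i \<omega> + real_of_ereal (breve_E E (\<lambda>\<omega>'. - Y i \<omega>'))) / ?a n))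
      = - limsup (\<lambda>n. ereal ((\<Sum>i=1..n. - Y i \<omega> - neg.mean) / ?a n))" for \<omega>
  proof -
    have "(\<Sum>i=1..n. - Y i \<omega> - neg.mean) / ?a n
        = - ((\<Sum>i=1..n. Y i \<omega> + real_of_ereal (breve_E E (\<lambda>\<omega>'. - Y i \<omega>'))) / ?a n)" for n
    proof -
      have "(\<Sum>i=1..n. - Y i \<omega> - neg.mean) = (\<Sum>i=1..n. - (Y i \<omega> + real_of_ereal (breve_E E (\<lambda>\<omega>'. - Y i \<omega>'))))"
        by (intro sum.cong refl) (simp add: neg.breve_E_Y)
      then show ?thesis by (simp only: sum_negf minus_divide_left)
    qed
    then show ?thesis
      by (simp only: uminus_ereal.simps(1)[symmetric] ereal_Limsup_uminus ereal_uminus_uminus)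
  qed
  moreover have "(\<Sum>i=1..n. Y i \<omega> - real_of_ereal (breve_E E (Y i))) = (\<Sum>i=1..n. Y i \<omega> - mean)" for n \<omega>
    by (intro sum.cong refl) (simp add: breve_E_Y)
  ultimately have "{\<omega> \<in> space M.
        liminf (\<lambda>n. ereal ((\<Sum>i=1..n. (Y i \<omega> + real_of_ereal (breve_E E (\<lambda>\<omega>'. - Y i \<omega>')))) / ?a n)) < - \<sigma>1 \<or>
        limsup (\<lambda>n. ereal ((\<Sum>i=1..n. (Y i \<omega> - real_of_ereal (breve_E E (Y i)))) / ?a n)) > \<sigma>2} \<subseteq> ?A \<union> ?B"
    by auto
  then show ?thesis by (intro null_imp_V_hat_star_eq_0 null_mono[OF null])
qed

end
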